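(* Let $\phi: D\to E$ be Hadamard differentiable at $H$ and at $R(H)$, tangentially to a measurable linear subspace $D_0\subset D$, with derivatives $\phi'_H$ and $\phi'_{R(H)}$. Suppose that, under $H$, - $\sqrt n(\mathbb H_n-H)\rightsquigarrow \mathbb G_H$ in $D$; - $\sqrt n(\mathbb H_n^*-R_n)\mid X_1,\dots,X_n\rightsquigarrow \mathbb G_{R(H)}$ in $D$, in outer probability; - the sequence $\sqrt n\,(R_n-R(H))$ is asymptotically tight in $D$; where $\mathbb G_H$ and $\mathbb G_{R(H)}$ are tight Borel measurable random elements taking their values in $D_0$. Then, under $H$, $$T_n\rightsquigarrow \|\phi_H'(\mathbb G_H)\|_E\quad\text{if }\phi(H)=0,\qquad\qquad T_n\rightsquigarrow\infty\quad\text{if }\phi(H)\neq 0,$$ while $$T_n^*\mid X_1,\dots,X_n\rightsquigarrow \|\phi'_{R(H)}(\mathbb G_{R(H)})\|_E,\qquad\text{in outer probability}.$$ If $\phi$ is uniformly Hadamard differentiable at $R(H)$ (tangentially to $D_0$), then the condition that the sequence $\sqrt n\,(R_n-R(H))$ is asymptotically tight in $D$ can be relaxed to the condition that $R_n\to R(H)$ in $D$ in outer probability. If, moreover, the convergence $\sqrt n(\mathbb H_n^*-R_n)\mid X_1,\dots,X_n\rightsquigarrow \mathbb G_{R(H)}$ in $D$ holds outer almost surely and $R_n\to R(H)$ outer almost surely, then the convergence $T_n^*\mid X_1,\dots,X_n\rightsquigarrow \|\phi'_{R(H)}(\mathbb G_{R(H)})\|_E$ holds also outer almost surely.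
   Context: Setting. $X_1,\dots,X_n$ are i.i.d. with distribution $H$ in a measurable space $(\mathcal X,\mathcal A)$. Probability measures on $\mathcal X$ are embedded in (identified with elements of) a normed space $(D,\|\cdot\|_D)$; $(E,\|\cdot\|_E)$ is a normed space. $\mathbb H_n=n^{-1}\sum_{i=1}^n\delta_{X_i}$ is the empirical distribution. $R_n=R_n(X_1,\dots,X_n)$ is a probability measure on $\mathcal X$ depending on the observations; given $X_1,\dots,X_n$, the bootstrap values $X_1^*,\dots,X_n^*$ are i.i.d. from $R_n$, and $\mathbb H_n^*=n^{-1}\sum_{i=1}^n\delta_{X_i^*}$. $R(H)$ is a deterministic element of $D$ (the limit of $R_n$ under $H$). Formally, $X_1,\dots,X_n$ are the coordinate projections on the first factor of a product probability space $(\mathcal X^n,\mathcal A^n,H^n)\times(\mathcal Z,\mathcal C,Q)$ (with $H^\infty$ the joint law of $(X_n)_{n\ge1}$ for almost sure statements), and the $X_i^*$ are measurable maps on this product which, for fixed $(x_1,\dots,x_n)$, are i.i.d. $R_n(x_1,\dots,x_n)$ under $Q$. The statistics are $$T_n=\sqrt n\,\|\phi(\mathbb H_n)\|_E,\qquad T_n^*=\sqrt n\,\|\phi(\mathbb H_n^* )-\phi(R_n)\|_E.$$ Weak convergence. $\rightsquigarrow$ is in the Hoffmann-Jørgensen sense: for possibly non-measurable maps $Y_n$ into a metric space $M$ and a Borel measurable $Y$, $Y_n\rightsquigarrow Y$ means $\mathbb E^{o}h(Y_n)\to\mathbb E h(Y)$ for every bounded continuous $h:M\to\mathbb R$, with $\mathbb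 E^{o}$ outer expectation. $T_n\rightsquigarrow\infty$ means that the inner probability of $\{T_n>t\}$ tends to $1$ for every $t$. Conditional weak convergence $Y_n^*\mid X_1,\dots,X_n\rightsquigarrow Y$ in $M$, outer almost surely or in outer probability, means $$\sup_{h\in \mathrm{BL}_1(M)}\bigl|\mathbb E[h(Y_n^* )^{o}\mid X_1,\dots,X_n]-\mathbb E h(Y)\bigr|\to0$$ outer almost surely or in outer probability (i.e. the left side is bounded by measurable variables tending to zero a.s. or in probability), where $\mathrm{BL}_1(M)$ is the set of functions $h:M\to[-1,1]$ that are Lipschitz with constant $1$, and $h(Y_n^* )^{o}$ is the least measurable majorant of $h(Y_n^* )$ on the product probability space. A sequence $Y_n$ is asymptotically tight if for every $\varepsilon>0$ there is a compact $K$ such that for every $\delta>0$ the liminf of the inner probabilities that $Y_n\in K^\delta$ is at least $1-\varepsilon$, with $K^\delta$ the $\delta$-enlargement of $K$. Differentiability. A map $\phi:D_\phi\subset D\to E$ is uniformly Hadamard differentiable at $H\in D_\phi$ tangentially to $D_0\subset D$ if there is a continuous linear map $\phi_H':\operatorname{lin}D_0\to E$ such that $t_n^{-1}(\phi(H_n+t_nh_n)-\phi(H_n))\to\phi_H'(h)$ for all $t_n\to0$ in $\mathbb R$, $H_n\to H$ in $D$, $h_n\to h\in D_0$ with $H_n\in D_\phi$ and $H_n+t_nh_n\in D_\phi$ for every $n$. It is Hadamard differentiable at $H$ tangentially to $D_0$ if this holds with $H_n=H$ for all $n$.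
   Formalization: Asymptotic tightness of √n(R_n − R(H)) is required with compact sets contained in D_0, not merely in D; with compact sets in D only, the first bootstrap claim fails when D_0 is smaller than D, since limit points may lie outside D_0. *)

theory Defs
  imports "HOL-Probability.Probability"
begin

section \<open>Sampling model\<close>

text \<open>
  The sample space is \<open>(space H, sets H)\<close>, with \<open>H\<close> the distribution of one observation. The
  observations \<open>X\<^sub>1, \<dots>, X\<^sub>n\<close> are the coordinates \<open>x 0, \<dots>, x (n - 1)\<close> of a point \<open>x\<close> of
  \<open>obs_space H n\<close>; \<open>Q\<close> is the additional randomness used to draw the bootstrap values.
\<close>

definition obs_space :: "'x measure \<Rightarrow> nat \<Rightarrow> (nat \<Rightarrow> 'x) measure" where
  "obs_space H n = PiM {..<n} (\<lambda>_. H)"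

definition boot_space :: "'x measure \<Rightarrow> 'z measure \<Rightarrow> nat \<Rightarrow> ((nat \<Rightarrow> 'x) \<times> 'z) measure" where
  "boot_space H Q n = obs_space H n \<Otimes>\<^sub>M Q"

text \<open>
  The empirical distribution is the law of \<open>x i\<close> for a uniformly chosen index \<open>i < n\<close>; the lemma
  below is the usual formula as an average of Dirac measures.
\<close>

definition empirical :: "'x measure \<Rightarrow> nat \<Rightarrow> (nat \<Rightarrow> 'x) \<Rightarrow> 'x measure" where
  "empirical H n x = distr (uniform_count_measure {..<n}) H x"

lemma measure_empirical:
  assumes "\<And>i. i < n \<Longrightarrow> x i \<in> space H" and "B \<in> sets H"
  shows "measure (empirical H n x) B = (\<Sum>i<n. measure (return H (x i)) B) / real n"
proof -
  have m: "x \<in> measurable (uniform_count_measure {..<n}) H"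
    using assms(1) by (auto simp: measurable_def space_uniform_count_measure sets_uniform_count_measure)
  have "measure (empirical H n x) B = real (card {i\<in>{..<n}. x i \<in> B}) / real n"
  proof -
    have "x -` B \<inter> {..<n} = {i\<in>{..<n}. x i \<in> B}" by auto
    then show ?thesis
      unfolding empirical_def using assms(2)
      by (simp add: measure_distr[OF m] space_uniform_count_measure measure_uniform_count_measure_if subset_eq)
  qed
  also have "real (card {i\<in>{..<n}. x i \<in> B}) = (\<Sum>i<n. indicator B (x i))"
    by (auto simp: indicator_def sum.If_cases Int_def)
  also have "\<dots> = (\<Sum>i<n. measure (return H (x i)) B)"
    using assms(2) by (intro sum.cong) (auto simp: measure_return)
  finally show ?thesis .
qed

definition boot_empirical ::
  "'x measure \<Rightarrow> (nat \<Rightarrow> nat \<Rightarrow> (nat \<Rightarrow> 'x) \<times> 'z \<Rightarrow> 'x) \<Rightarrow> nat \<Rightarrow> (nat \<Rightarrow> 'x) \<times> 'z \<Rightarrow> 'x measure" where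
  "boot_empirical H Xs n \<omega> = empirical H n (\<lambda>i. Xs n i \<omega>)"

text \<open>
  Probability measures are identified with elements of the normed space through the map \<open>emb\<close>.
\<close>

definition test_stat ::
  "('x measure \<Rightarrow> 'd) \<Rightarrow> ('d \<Rightarrow> 'e::real_normed_vector) \<Rightarrow> 'x measure
    \<Rightarrow> nat \<Rightarrow> (nat \<Rightarrow> 'x) \<Rightarrow> real" where
  "test_stat emb \<phi> H n x = sqrt (real n) * norm (\<phi> (emb (empirical H n x)))"

definition boot_test_stat ::
  "('x measure \<Rightarrow> 'd) \<Rightarrow> ('d \<Rightarrow> 'e::real_normed_vector) \<Rightarrow> 'x measure
    \<Rightarrow> (nat \<Rightarrow> (nat \<Rightarrow> 'x) \<Rightarrow> 'x measure) \<Rightarrow> (nat \<Rightarrow> nat \<Rightarrow> (nat \<Rightarrow> 'x) \<times> 'z \<Rightarrow> 'x)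
    \<Rightarrow> nat \<Rightarrow> (nat \<Rightarrow> 'x) \<times> 'z \<Rightarrow> real" where
  "boot_test_stat emb \<phi> H R Xs n \<omega> =
     sqrt (real n) * norm (\<phi> (emb (boot_empirical H Xs n \<omega>)) - \<phi> (emb (R n (fst \<omega>))))"

section \<open>Weak convergence of possibly non-measurable maps\<close>

text \<open>
  Only applied to bounded \<open>f\<close> on a probability space, where the infimum is over a nonempty set that
  is bounded below, and where real-valued integrable majorants suffice.
\<close>

definition outer_expectation :: "'w measure \<Rightarrow> ('w \<Rightarrow> real) \<Rightarrow> real" where
  "outer_expectation M f =
     (INF U \<in> {U. integrable M U \<and> (\<forall>\<omega>\<in>space M. f \<omega> \<le> U \<omega>)}. \<integral>\<omega>. U \<omega> \<partial>M)"

definition inner_prob :: "'w measure \<Rightarrow> 'w set \<Rightarrow> real" where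
  "inner_prob M S = (SUP A \<in> {A \<in> sets M. A \<subseteq> S}. measure M A)"

text \<open>The limit is the random element \<open>G\<close> defined on the probability space \<open>P\<close>.\<close>

definition weak_conv_HJ ::
  "(nat \<Rightarrow> 'w measure) \<Rightarrow> (nat \<Rightarrow> 'w \<Rightarrow> 'm::metric_space) \<Rightarrow> 'p measure \<Rightarrow> ('p \<Rightarrow> 'm) \<Rightarrow> bool" where
  "weak_conv_HJ M Y P G \<longleftrightarrow>
     (\<forall>h :: 'm \<Rightarrow> real. continuous_on UNIV h \<and> bounded (range h) \<longrightarrow>
        (\<lambda>n. outer_expectation (M n) (\<lambda>\<omega>. h (Y n \<omega>))) \<longlonglongrightarrow> (\<integral>\<omega>. h (G \<omega>) \<partial>P))"

definition weak_conv_infinity :: "(nat \<Rightarrow> 'w measure) \<Rightarrow> (nat \<Rightarrow> 'w \<Rightarrow> real) \<Rightarrow> bool" where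
  "weak_conv_infinity M T \<longleftrightarrow>
     (\<forall>t. (\<lambda>n. inner_prob (M n) {\<omega> \<in> space (M n). T n \<omega> > t}) \<longlonglongrightarrow> 1)"

definition tight_in :: "'p measure \<Rightarrow> ('p \<Rightarrow> 'm::metric_space) \<Rightarrow> bool" where
  "tight_in P G \<longleftrightarrow>
     (\<forall>\<epsilon>>0. \<exists>K. compact K \<and> measure P {\<omega> \<in> space P. G \<omega> \<in> K} \<ge> 1 - \<epsilon>)"

text \<open>
  Asymptotic tightness with compact sets contained in \<open>S\<close>; \<open>S = UNIV\<close> is asymptotic tightness in
  the whole space. When a map is differentiable only tangentially to \<open>D\<^sub>0\<close>, the delta method needs
  the limit points of the sequence to lie in \<open>D\<^sub>0\<close>, that is \<open>S = D\<^sub>0\<close>.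
\<close>

definition asymptotically_tight_in ::
  "'m::metric_space set \<Rightarrow> (nat \<Rightarrow> 'w measure) \<Rightarrow> (nat \<Rightarrow> 'w \<Rightarrow> 'm) \<Rightarrow> bool" where
  "asymptotically_tight_in S M Y \<longleftrightarrow>
     (\<forall>\<epsilon>>0. \<exists>K. compact K \<and> K \<subseteq> S \<and>
        (\<forall>\<delta>>0. liminf (\<lambda>n. ereal (inner_prob (M n) {\<omega> \<in> space (M n). Y n \<omega> \<in> (\<Union>k\<in>K. ball k \<delta>)}))
                 \<ge> ereal (1 - \<epsilon>)))"

section \<open>Outer convergence to zero\<close>

text \<open>
  Here \<open>Z n\<close> is a nonnegative, possibly non-measurable function of the first \<open>n\<close> observations.
\<close>

definition outer_majorized ::
  "'x measure \<Rightarrow> (nat \<Rightarrow> (nat \<Rightarrow> 'x) \<Rightarrow> real) \<Rightarrow> (nat \<Rightarrow> (nat \<Rightarrow> 'x) \<Rightarrow> real) \<Rightarrow> bool" where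
  "outer_majorized H Z \<Delta> \<longleftrightarrow>
     (\<forall>n. \<Delta> n \<in> borel_measurable (obs_space H n) \<and> (\<forall>x\<in>space (obs_space H n). Z n x \<le> \<Delta> n x))"

definition tendsto_0_outer_prob :: "'x measure \<Rightarrow> (nat \<Rightarrow> (nat \<Rightarrow> 'x) \<Rightarrow> real) \<Rightarrow> bool" where
  "tendsto_0_outer_prob H Z \<longleftrightarrow>
     (\<exists>\<Delta>. outer_majorized H Z \<Delta> \<and>
        (\<forall>\<epsilon>>0. (\<lambda>n. measure (obs_space H n) {x \<in> space (obs_space H n). \<bar>\<Delta> n x\<bar> > \<epsilon>}) \<longlonglongrightarrow> 0))"

definition tendsto_0_outer_as :: "'x measure \<Rightarrow> (nat \<Rightarrow> (nat \<Rightarrow> 'x) \<Rightarrow> real) \<Rightarrow> bool" where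
  "tendsto_0_outer_as H Z \<longleftrightarrow>
     (\<exists>\<Delta>. outer_majorized H Z \<Delta> \<and>
        (AE x in PiM UNIV (\<lambda>_::nat. H). (\<lambda>n. \<Delta> n (restrict x {..<n})) \<longlonglongrightarrow> 0))"

section \<open>Conditional weak convergence\<close>

definition BL1 :: "('m::metric_space \<Rightarrow> real) set" where
  "BL1 = {h. range h \<subseteq> {-1..1} \<and> 1-lipschitz_on UNIV h}"

definition least_measurable_majorant :: "'w measure \<Rightarrow> ('w \<Rightarrow> real) \<Rightarrow> ('w \<Rightarrow> real) \<Rightarrow> bool" where
  "least_measurable_majorant M f g \<longleftrightarrow>
     g \<in> borel_measurable M \<and> (\<forall>\<omega>\<in>space M. f \<omega> \<le> g \<omega>) \<and>
     (\<forall>U \<in> borel_measurable M. (AE \<omega> in M. f \<omega> \<le> U \<omega>) \<longrightarrow> (AE \<omega> in M. g \<omega> \<le> U \<omega>))"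

text \<open>
  Least measurable majorants, and hence the conditional expectations given the observations, are
  determined only up to null sets, whereas the supremum below is over an uncountable class. A family
  of versions \<open>V n h\<close> of \<open>h(Y\<^sub>n)\<^sup>o\<close> is therefore chosen first. As \<open>h \<le> 1\<close>, a version can
  be taken at most 1 everywhere, so that all its sections are \<open>Q\<close>-integrable.
\<close>

definition majorant_versions ::
  "'x measure \<Rightarrow> 'z measure \<Rightarrow> (nat \<Rightarrow> (nat \<Rightarrow> 'x) \<times> 'z \<Rightarrow> 'm::metric_space)
    \<Rightarrow> (nat \<Rightarrow> ('m \<Rightarrow> real) \<Rightarrow> (nat \<Rightarrow> 'x) \<times> 'z \<Rightarrow> real) \<Rightarrow> bool" where
  "majorant_versions H Q Y V \<longleftrightarrow>
     (\<forall>n. \<forall>h\<in>BL1. least_measurable_majorant (boot_space H Q n) (\<lambda>\<omega>. h (Y n \<omega>)) (V n h) \<and>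
        (\<forall>\<omega>\<in>space (boot_space H Q n). V n h \<omega> \<le> 1))"

text \<open>
  On the product space the conditional expectation given the observations is integration over \<open>Q\<close>.
\<close>

definition cond_BL_dist ::
  "'z measure \<Rightarrow> (('m::metric_space \<Rightarrow> real) \<Rightarrow> (nat \<Rightarrow> 'x) \<times> 'z \<Rightarrow> real)
    \<Rightarrow> 'p measure \<Rightarrow> ('p \<Rightarrow> 'm) \<Rightarrow> (nat \<Rightarrow> 'x) \<Rightarrow> real" where
  "cond_BL_dist Q v P G x = (SUP h\<in>BL1. \<bar>(\<integral>z. v h (x, z) \<partial>Q) - (\<integral>\<omega>. h (G \<omega>) \<partial>P)\<bar>)"

definition cond_weak_conv_prob ::
  "'x measure \<Rightarrow> 'z measure \<Rightarrow> (nat \<Rightarrow> (nat \<Rightarrow> 'x) \<times> 'z \<Rightarrow> 'm::metric_space)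
    \<Rightarrow> 'p measure \<Rightarrow> ('p \<Rightarrow> 'm) \<Rightarrow> bool" where
  "cond_weak_conv_prob H Q Y P G \<longleftrightarrow>
     (\<exists>V. majorant_versions H Q Y V \<and> tendsto_0_outer_prob H (\<lambda>n. cond_BL_dist Q (V n) P G))"

definition cond_weak_conv_as ::
  "'x measure \<Rightarrow> 'z measure \<Rightarrow> (nat \<Rightarrow> (nat \<Rightarrow> 'x) \<times> 'z \<Rightarrow> 'm::metric_space)
    \<Rightarrow> 'p measure \<Rightarrow> ('p \<Rightarrow> 'm) \<Rightarrow> bool" where
  "cond_weak_conv_as H Q Y P G \<longleftrightarrow>
     (\<exists>V. majorant_versions H Q Y V \<and> tendsto_0_outer_as H (\<lambda>n. cond_BL_dist Q (V n) P G))"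

section \<open>Hadamard differentiability\<close>

definition continuous_linear_on_span ::
  "'d::real_normed_vector set \<Rightarrow> ('d \<Rightarrow> 'e::real_normed_vector) \<Rightarrow> bool" where
  "continuous_linear_on_span D0 L \<longleftrightarrow>
     (\<forall>x\<in>span D0. \<forall>y\<in>span D0. L (x + y) = L x + L y) \<and>
     (\<forall>c. \<forall>x\<in>span D0. L (c *\<^sub>R x) = c *\<^sub>R L x) \<and>
     continuous_on (span D0) L"

definition has_hadamard_derivative ::
  "('d::real_normed_vector \<Rightarrow> 'e::real_normed_vector) \<Rightarrow> 'd set \<Rightarrow> 'd set \<Rightarrow> 'd \<Rightarrow> ('d \<Rightarrow> 'e) \<Rightarrow> bool" where
  "has_hadamard_derivative \<phi> D\<^sub>\<phi> D0 \<theta> L \<longleftrightarrow>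
     \<theta> \<in> D\<^sub>\<phi> \<and> continuous_linear_on_span D0 L \<and>
     (\<forall>(t :: nat \<Rightarrow> real) hs h.
        t \<longlonglongrightarrow> 0 \<and> (\<forall>n. t n \<noteq> 0) \<and> hs \<longlonglongrightarrow> h \<and> h \<in> D0 \<and>
        (\<forall>n. \<theta> + t n *\<^sub>R hs n \<in> D\<^sub>\<phi>) \<longrightarrow>
        (\<lambda>n. inverse (t n) *\<^sub>R (\<phi> (\<theta> + t n *\<^sub>R hs n) - \<phi> \<theta>)) \<longlonglongrightarrow> L h)"

definition has_uniform_hadamard_derivative ::
  "('d::real_normed_vector \<Rightarrow> 'e::real_normed_vector) \<Rightarrow> 'd set \<Rightarrow> 'd set \<Rightarrow> 'd \<Rightarrow> ('d \<Rightarrow> 'e) \<Rightarrow> bool" where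
  "has_uniform_hadamard_derivative \<phi> D\<^sub>\<phi> D0 \<theta> L \<longleftrightarrow>
     \<theta> \<in> D\<^sub>\<phi> \<and> continuous_linear_on_span D0 L \<and>
     (\<forall>(t :: nat \<Rightarrow> real) \<theta>s hs h.
        t \<longlonglongrightarrow> 0 \<and> (\<forall>n. t n \<noteq> 0) \<and> \<theta>s \<longlonglongrightarrow> \<theta> \<and> hs \<longlonglongrightarrow> h \<and> h \<in> D0 \<and>
        (\<forall>n. \<theta>s n \<in> D\<^sub>\<phi> \<and> \<theta>s n + t n *\<^sub>R hs n \<in> D\<^sub>\<phi>) \<longrightarrow>
        (\<lambda>n. inverse (t n) *\<^sub>R (\<phi> (\<theta>s n + t n *\<^sub>R hs n) - \<phi> (\<theta>s n))) \<longlonglongrightarrow> L h)"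

end

theory Submission
  imports Defs
begin

text \<open>
  The delta method is reduced to one inequality between functions. Collect in a set \<open>F k\<close> the pairs
  \<open>(y, c)\<close> in which \<open>y\<close> is a rescaled deviation and \<open>c\<close> the value of the statistic that it produces at
  some sample size \<open>m \<ge> k\<close>. By Hadamard differentiability \<open>c\<close> converges to the
  value \<open>f y\<close> of the derivative when \<open>k \<rightarrow> \<infinity>\<close> and the first components tend to a point \<open>y\<close> of \<open>D0\<close>.
  For \<open>h\<close> in \<open>BL1\<close> the function
  \<open>u y = sup {h c - k * dist y y' | (y', c) \<in> F k}\<close>, truncated below at \<open>-1\<close>, is \<open>k\<close>-Lipschitz,
  satisfies \<open>h c \<le> u y\<close> for every pair in \<open>F k\<close>, and exceeds \<open>h (f y)\<close> on \<open>D0\<close> by at most a modulus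
  \<open>w k y\<close> that is the same for all \<open>h\<close> and tends to 0 pointwise. Dominated convergence then gives
  \<open>E u(G) \<le> E h(f(G)) + \<epsilon>\<close> for large \<open>k\<close>, uniformly in \<open>h\<close> (\<open>lipschitz_envelope\<close>).

  Since \<open>h(T) \<le> u(Y)\<close> holds pointwise, and \<open>u\<close> is continuous, an upper bound for outer
  expectations of \<open>h(T)\<close> follows from the weak convergence of \<open>Y\<close>; the matching lower bound is the
  upper bound for \<open>- h\<close>. This yields the limits of the test statistic under the null hypothesis and
  under the alternative (\<open>weak_conv_delta_method\<close>, \<open>weak_conv_infinity_delta_method\<close>). The same
  inequality serves the bootstrap: \<open>u / k\<close> belongs to \<open>BL1\<close>, so that \<open>k\<close> times the bounded Lipschitz
  distance for \<open>Y\<close>, plus \<open>\<epsilon>\<close>, bounds the one for \<open>T\<close> at every sample point at which the inequality is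
  available (\<open>cond_weak_conv_transfer\<close>). The versions of the least measurable majorants of
  \<open>h(T)\<close> are chosen as minima with the majorants that the envelopes provide, and therefore the bound
  holds simultaneously for the uncountably many \<open>h\<close>.

  In the bootstrap the derivative is taken at the random point \<open>R\<^sub>n\<close>, which enters the definition of
  \<open>F k\<close> through a neighbourhood to which \<open>R\<^sub>n\<close> is confined with high probability, or eventually almost
  surely: a ball around the limit \<open>R(H)\<close> when \<open>\<phi>\<close> is uniformly differentiable, and the set of
  \<open>\<theta>\<close> with \<open>\<surd>n (\<theta> - R(H))\<close> close to a compact \<open>K \<subseteq> D0\<close> in the asymptotically tight case. In the
  latter, along a subsequence \<open>\<surd>n (R\<^sub>n - R(H))\<close> tends to some \<open>l\<close> in \<open>K\<close>, and the rescaled increment of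
  \<open>\<phi>\<close> tends to \<open>\<phi>'(l + y) - \<phi>'(l) = \<phi>'(y)\<close>.
\<close>

section \<open>Lipschitz envelopes of continuously convergent statistics\<close>

lemma SUP_le_SUP_add:
  fixes g g' :: "'i \<Rightarrow> real"
  assumes "bdd_above (range g')" and "\<And>p. g p \<le> g' p + b"
  shows "(SUP p. g p) \<le> (SUP p. g' p) + b"
proof (rule cSUP_least)
  fix p
  have "g p \<le> g' p + b" by (rule assms(2))
  also have "g' p \<le> (SUP p. g' p)" by (rule cSUP_upper[OF _ assms(1)]) simp
  finally show "g p \<le> (SUP p. g' p) + b" by simp
qed simp

lemma SUP_in_interval:
  fixes g :: "'i \<Rightarrow> real"
  assumes "\<And>p. g p \<in> {a..b}"
  shows "(SUP p. g p) \<in> {a..b}"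
proof -
  have "bdd_above (range g)" using assms by (intro bdd_aboveI[of _ b]) auto
  then have "g undefined \<le> (SUP p. g p)" by (intro cSUP_upper) auto
  moreover have "(SUP p. g p) \<le> b" using assms by (intro cSUP_least) auto
  moreover have "a \<le> g undefined" using assms by auto
  ultimately show ?thesis by auto
qed

lemma (in prob_space) integrable_in_interval:
  fixes g :: "'a \<Rightarrow> real"
  assumes "g \<in> borel_measurable M" and "\<And>\<omega>. \<omega> \<in> space M \<Longrightarrow> g \<omega> \<in> {- c..c}"
  shows "integrable M g"
  using assms by (intro integrable_const_bound[where B=c] AE_I2) (auto simp: abs_le_iff minus_le_iff)

lemma (in prob_space) abs_integral_le:
  fixes g :: "'a \<Rightarrow> real"
  assumes "\<And>\<omega>. \<omega> \<in> space M \<Longrightarrow> g \<omega> \<in> {- 1..1}"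
  shows "\<bar>\<integral>\<omega>. g \<omega> \<partial>M\<bar> \<le> 1"
proof (cases "integrable M g")
  case True
  have "(\<integral>\<omega>. g \<omega> \<partial>M) \<le> 1" using True assms by (intro integral_le_const) auto
  moreover have "- 1 \<le> (\<integral>\<omega>. g \<omega> \<partial>M)" using True assms by (intro integral_ge_const) auto
  ultimately show ?thesis by auto
next
  case False
  then show ?thesis by (simp add: not_integrable_integral_eq)
qed

lemma BL1_D:
  assumes "h \<in> BL1"
  shows "h x \<in> {- 1..1}" and "\<bar>h x - h y\<bar> \<le> dist x y" and "continuous_on UNIV h"
proof -
  have L: "1-lipschitz_on UNIV h" and r: "range h \<subseteq> {-1..1}" using assms by (auto simp: BL1_def)
  show "h x \<in> {- 1..1}" using r by (rule subsetD) simp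
  show "\<bar>h x - h y\<bar> \<le> dist x y" using lipschitz_onD[OF L, of x y] by (simp add: dist_real_def)
  show "continuous_on UNIV h" by (rule lipschitz_on_continuous_on[OF L])
qed

text \<open>
  Restricting to the set in which \<open>G\<close> takes its values makes a function measurable that is continuous
  there, whatever its values elsewhere.
\<close>

lemma borel_measurable_continuous_on_compose:
  assumes "continuous_on S f" and "G \<in> measurable M borel" and "\<And>\<omega>. \<omega> \<in> space M \<Longrightarrow> G \<omega> \<in> S"
  shows "(\<lambda>\<omega>. f (G \<omega>)) \<in> borel_measurable M"
proof -
  have "G \<in> measurable M (restrict_space borel S)"
    using assms by (intro measurable_restrict_space2) auto
  then show ?thesis
    using borel_measurable_continuous_on_restrict[OF assms(1)] by (rule measurable_compose)
qed

text \<open>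
  In the envelope, \<open>d\<close> is the penalty \<open>k * dist y y'\<close>, \<open>c\<close> a value of the statistic and \<open>f\<close> its limit,
  with \<open>hc\<close> and \<open>hf\<close> their images under a function in \<open>BL1\<close>. Only \<open>hf\<close> depends on that function in
  the bound, the excess does not.
\<close>

lemma cone_le_modulus:
  fixes c d f hc hf :: real
  assumes "\<bar>hc - hf\<bar> \<le> \<bar>c - f\<bar>" and "hc \<in> {-1..1}" and "hf \<in> {-1..1}"
  shows "max (-1) (hc - d) \<le> hf + max 0 (min 2 \<bar>c - f\<bar> - d)"
  using assms by (auto simp: max_def min_def)

text \<open>
  The hypothesis \<open>conv\<close> is the continuous mapping condition in a form that allows limits to exist along
  subsequences only. If \<open>w k y\<close> did not tend to 0, then pairs in \<open>F k\<close> with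
  \<open>\<bar>c - f y\<bar>\<close> bounded away from 0 would have first components at distance at most \<open>2 / k\<close> from \<open>y\<close>,
  against this condition. The modulus \<open>w k\<close> is continuous on \<open>D0\<close>, being Lipschitz in \<open>y\<close> and in
  \<open>f y\<close>, which makes its expectation meaningful although it is a supremum of arbitrary functions.
\<close>

lemma lipschitz_envelope:
  fixes F :: "nat \<Rightarrow> ('d::metric_space \<times> real) set" and G :: "'p \<Rightarrow> 'd" and f :: "'d \<Rightarrow> real"
  assumes P: "prob_space P" and G: "G \<in> measurable P borel" "\<And>\<omega>. \<omega> \<in> space P \<Longrightarrow> G \<omega> \<in> D0"
    and f: "continuous_on D0 f"
    and dec: "\<And>k l. k \<le> l \<Longrightarrow> F l \<subseteq> F k"
    and conv: "\<And>y p. y \<in> D0 \<Longrightarrow> (\<And>k. p k \<in> F k) \<Longrightarrow> (\<lambda>k. fst (p k)) \<longlonglongrightarrow> y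
        \<Longrightarrow> \<exists>r::nat \<Rightarrow> nat. strict_mono r \<and> (\<lambda>k. snd (p (r k))) \<longlonglongrightarrow> f y"
    and "0 < \<epsilon>"
  shows "\<exists>k\<ge>1. \<forall>h\<in>BL1. \<exists>u. (real k)-lipschitz_on UNIV u \<and> range u \<subseteq> {-1..1} \<and>
      (\<integral>\<omega>. u (G \<omega>) \<partial>P) \<le> (\<integral>\<omega>. h (f (G \<omega>)) \<partial>P) + \<epsilon> \<and> (\<forall>(y, c)\<in>F k. h c \<le> u y)"
proof -
  interpret prob_space P by (rule P)
  \<comment> \<open>The supremum ranges over all pairs, with value 0 off \<open>F k\<close>, so that it is also correct for empty \<open>F k\<close>.\<close>
  define g where "g k y p = (if p \<in> F k then max 0 (min 2 \<bar>snd p - f y\<bar> - real k * dist y (fst p)) else 0)"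
    for k y p
  define w where "w k y = (SUP p. g k y p)" for k y
  have g_range: "g k y p \<in> {0..2}" for k y p
  proof -
    have "max 0 (min 2 a - d) \<in> {0..2}" if "0 \<le> d" for a d :: real using that by auto
    then show ?thesis unfolding g_def by simp
  qed
  have g_bdd: "bdd_above (range (g k y))" for k y
    using g_range by (intro bdd_aboveI[of _ 2]) auto
  have w_range: "w k y \<in> {0..2}" for k y unfolding w_def by (rule SUP_in_interval[OF g_range])
  have w_step: "w k y \<le> w k y' + (real k * dist y y' + \<bar>f y - f y'\<bar>)" for k y y'
    unfolding w_def
  proof (rule SUP_le_SUP_add[OF g_bdd])
    fix p :: "'d \<times> real"
    have "real k * dist y' (fst p) \<le> real k * (dist y y' + dist y (fst p))"
      by (intro mult_left_mono) (metis dist_commute dist_triangle, simp)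
    then show "g k y p \<le> g k y' p + (real k * dist y y' + \<bar>f y - f y'\<bar>)"
      by (auto simp: g_def max_def min_def distrib_left)
  qed
  have w_cont: "continuous_on D0 (w k)" for k
    unfolding continuous_on_def
  proof
    fix y assume y: "y \<in> D0"
    have "((\<lambda>y'. real k * dist y' y + \<bar>f y' - f y\<bar>) \<longlongrightarrow> real k * dist y y + \<bar>f y - f y\<bar>) (at y within D0)"
      using f y by (intro tendsto_intros) (auto simp: continuous_on_def)
    then have lim: "((\<lambda>y'. real k * dist y' y + \<bar>f y' - f y\<bar>) \<longlongrightarrow> 0) (at y within D0)" by simp
    have "dist (w k y') (w k y) \<le> real k * dist y' y + \<bar>f y' - f y\<bar>" for y'
      using w_step[of k y y'] w_step[of k y' y]
      by (auto simp: dist_real_def dist_commute abs_minus_commute abs_le_iff)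
    then show "(w k \<longlongrightarrow> w k y) (at y within D0)"
      by (intro metric_tendsto_imp_tendsto[OF lim]) (auto intro!: always_eventually)
  qed
  have w_lim: "(\<lambda>k. w k y) \<longlonglongrightarrow> 0" if y: "y \<in> D0" for y
  proof (rule ccontr)
    assume "\<not> (\<lambda>k. w k y) \<longlonglongrightarrow> 0"
    then obtain \<eta> where \<eta>: "0 < \<eta>" "\<And>N. \<exists>k\<ge>N. \<eta> \<le> w k y"
      using w_range by (auto simp: LIMSEQ_def dist_real_def not_less)
    have w_anti: "w l y \<le> w k y" if "k \<le> l" for k l
    proof -
      have "w l y \<le> w k y + 0" unfolding w_def
      proof (rule SUP_le_SUP_add[OF g_bdd])
        fix p :: "'d \<times> real"
        have "real k * dist y (fst p) \<le> real l * dist y (fst p)"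
          using that by (intro mult_right_mono) auto
        then show "g l y p \<le> g k y p + 0"
          using dec[OF that] by (auto simp: g_def max_def min_def)
      qed
      then show ?thesis by simp
    qed
    have "\<exists>p. p \<in> F k \<and> \<eta> / 2 < min 2 \<bar>snd p - f y\<bar> - real k * dist y (fst p)" for k
    proof -
      obtain l where "k \<le> l" "\<eta> \<le> w l y" using \<eta>(2) by blast
      with w_anti[of k l] \<eta>(1) have "\<eta> / 2 < w k y" by linarith
      then obtain p where "\<eta> / 2 < g k y p"
        unfolding w_def less_cSUP_iff[OF UNIV_not_empty g_bdd] by blast
      with \<eta>(1) show ?thesis by (intro exI[of _ p]) (auto simp: g_def max_def split: if_splits)
    qed
    then obtain p where p: "\<And>k. p k \<in> F k"
      "\<And>k. \<eta> / 2 < min 2 \<bar>snd (p k) - f y\<bar> - real k * dist y (fst (p k))" by metis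
    have near: "dist (fst (p k)) y \<le> 2 / real k" if "k \<ge> 1" for k
      using p(2)[of k] \<eta>(1) that by (simp add: field_simps dist_commute)
    have "(\<lambda>k. fst (p k)) \<longlonglongrightarrow> y"
    proof (rule metric_tendsto_imp_tendsto[where f="\<lambda>k. 2 / real k" and a=0])
      show "(\<lambda>k. 2 / real k) \<longlonglongrightarrow> 0" by (rule lim_const_over_n)
      show "\<forall>\<^sub>F k in sequentially. dist (fst (p k)) y \<le> dist (2 / real k) 0"
        using near by (auto simp: dist_real_def intro!: eventually_sequentiallyI[of 1])
    qed
    from conv[OF y p(1) this] obtain r where "(\<lambda>k. snd (p (r k))) \<longlonglongrightarrow> f y" by auto
    then have "\<forall>\<^sub>F k in sequentially. dist (snd (p (r k))) (f y) < \<eta> / 2"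
      using \<eta>(1) by (intro tendstoD) auto
    then obtain k where "dist (snd (p (r k))) (f y) < \<eta> / 2"
      using eventually_happens by fastforce
    then have "\<bar>snd (p (r k)) - f y\<bar> < \<eta> / 2" by (simp add: dist_real_def)
    moreover have "0 \<le> real (r k) * dist y (fst (p (r k)))" by simp
    ultimately show False using p(2)[of "r k"] by linarith
  qed
  have w_meas: "(\<lambda>\<omega>. w k (G \<omega>)) \<in> borel_measurable P" for k
    by (rule borel_measurable_continuous_on_compose[OF w_cont G])
  have w_int: "integrable P (\<lambda>\<omega>. w k (G \<omega>))" for k
    using w_meas w_range by (intro integrable_in_interval[where c=2]) (auto intro: order_trans[of _ 0])
  have "(\<lambda>k. \<integral>\<omega>. w k (G \<omega>) \<partial>P) \<longlonglongrightarrow> (\<integral>\<omega>. 0 \<partial>P)"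
  proof (rule integral_dominated_convergence[where w="\<lambda>_. 2"])
    show "AE \<omega> in P. (\<lambda>k. w k (G \<omega>)) \<longlonglongrightarrow> 0" using w_lim G(2) by (intro AE_I2) auto
    show "AE \<omega> in P. norm (w k (G \<omega>)) \<le> 2" for k using w_range by (intro AE_I2) auto
  qed (auto intro: w_meas)
  then have "\<forall>\<^sub>F k in sequentially. (\<integral>\<omega>. w k (G \<omega>) \<partial>P) < \<epsilon>"
    using \<open>0 < \<epsilon>\<close> by (intro order_tendstoD(2)) auto
  then have "\<forall>\<^sub>F k in sequentially. (\<integral>\<omega>. w k (G \<omega>) \<partial>P) < \<epsilon> \<and> 1 \<le> k"
    using eventually_ge_at_top by (rule eventually_conj)
  then obtain k where k: "1 \<le> k" "(\<integral>\<omega>. w k (G \<omega>) \<partial>P) < \<epsilon>"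
    using eventually_happens by fastforce
  have "\<exists>u. (real k)-lipschitz_on UNIV u \<and> range u \<subseteq> {-1..1} \<and>
      (\<integral>\<omega>. u (G \<omega>) \<partial>P) \<le> (\<integral>\<omega>. h (f (G \<omega>)) \<partial>P) + \<epsilon> \<and> (\<forall>(y, c)\<in>F k. h c \<le> u y)" if h: "h \<in> BL1" for h
  proof -
    \<comment> \<open>The value \<open>-1\<close> off \<open>F k\<close> again covers empty \<open>F k\<close>.\<close>
    define v where "v y p = (if p \<in> F k then max (-1) (h (snd p) - real k * dist y (fst p)) else -1)" for y p
    define u where "u y = (SUP p. v y p)" for y
    have v_range: "v y p \<in> {-1..1}" for y p
    proof -
      have clip: "max (-1) (a - d) \<in> {-1..1}" if "0 \<le> d" "a \<in> {-1..1}" for a d :: real using that by auto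
      have "max (-1) (h (snd p) - real k * dist y (fst p)) \<in> {-1..1}"
        by (rule clip[OF _ BL1_D(1)[OF h]]) simp
      then show ?thesis unfolding v_def by simp
    qed
    have v_bdd: "bdd_above (range (v y))" for y using v_range by (intro bdd_aboveI[of _ 1]) auto
    have u_range: "u y \<in> {-1..1}" for y unfolding u_def by (rule SUP_in_interval[OF v_range])
    have u_step: "u y \<le> u y' + real k * dist y y'" for y y'
      unfolding u_def
    proof (rule SUP_le_SUP_add[OF v_bdd])
      fix p :: "'d \<times> real"
      have "real k * dist y' (fst p) \<le> real k * (dist y y' + dist y (fst p))"
        by (intro mult_left_mono) (metis dist_commute dist_triangle, simp)
      moreover have "max (-1) (a - d) \<le> max (-1) (a - d') + e" if "d' \<le> e + d" "0 \<le> e" for a d d' e :: real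
        using that by auto
      ultimately show "v y p \<le> v y' p + real k * dist y y'"
        unfolding v_def by (simp add: distrib_left)
    qed
    have u_lip: "(real k)-lipschitz_on UNIV u"
    proof (rule lipschitz_onI)
      fix y y'
      show "dist (u y) (u y') \<le> real k * dist y y'"
        using u_step[of y y'] u_step[of y' y] by (auto simp: dist_real_def dist_commute abs_le_iff)
    qed simp
    have u_le: "u y \<le> h (f y) + w k y" for y
    proof -
      have "u y \<le> w k y + h (f y)" unfolding u_def w_def
      proof (rule SUP_le_SUP_add[OF g_bdd])
        fix p :: "'d \<times> real"
        show "v y p \<le> g k y p + h (f y)"
          using cone_le_modulus[of "h (snd p)" "h (f y)" "snd p" "f y" "real k * dist y (fst p)"]
            BL1_D(1)[OF h, of "snd p"] BL1_D(1)[OF h, of "f y"] BL1_D(2)[OF h, of "snd p" "f y"]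
          by (auto simp: v_def g_def dist_real_def)
      qed
      then show ?thesis by simp
    qed
    have u_int: "integrable P (\<lambda>\<omega>. u (G \<omega>))"
      using borel_measurable_continuous_on_compose[OF lipschitz_on_continuous_on[OF u_lip] G(1)] u_range
      by (intro integrable_in_interval[where c=1]) auto
    have h_int: "integrable P (\<lambda>\<omega>. h (f (G \<omega>)))"
      using borel_measurable_continuous_on_compose
          [OF continuous_on_compose2[OF BL1_D(3)[OF h] f subset_UNIV] G] BL1_D(1)[OF h]
      by (intro integrable_in_interval[where c=1]) auto
    have "(\<integral>\<omega>. u (G \<omega>) \<partial>P) \<le> (\<integral>\<omega>. h (f (G \<omega>)) + w k (G \<omega>) \<partial>P)"
      using u_int h_int w_int u_le by (intro integral_mono) auto
    also have "\<dots> = (\<integral>\<omega>. h (f (G \<omega>)) \<partial>P) + (\<integral>\<omega>. w k (G \<omega>) \<partial>P)"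
      using h_int w_int by (rule Bochner_Integration.integral_add)
    finally have "(\<integral>\<omega>. u (G \<omega>) \<partial>P) \<le> (\<integral>\<omega>. h (f (G \<omega>)) \<partial>P) + \<epsilon>" using k(2) by simp
    moreover have "h c \<le> u y" if "(y, c) \<in> F k" for y c
    proof -
      have "h c \<le> v y (y, c)" using that by (simp add: v_def)
      also have "\<dots> \<le> u y" unfolding u_def by (rule cSUP_upper[OF _ v_bdd]) simp
      finally show ?thesis .
    qed
    ultimately show ?thesis using u_lip u_range by (intro exI[of _ u]) auto
  qed
  with k(1) show ?thesis by blast
qed

section \<open>Outer expectations and inner probabilities\<close>

lemma (in prob_space) outer_expectation_le:
  fixes f :: "'a \<Rightarrow> real"
  assumes "integrable M U" and "\<And>\<omega>. \<omega> \<in> space M \<Longrightarrow> f \<omega> \<le> U \<omega>" and "\<And>\<omega>. \<omega> \<in> space M \<Longrightarrow> b \<le> f \<omega>"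
  shows "outer_expectation M f \<le> (\<integral>\<omega>. U \<omega> \<partial>M)"
  unfolding outer_expectation_def
proof (rule cINF_lower)
  show "bdd_below ((\<lambda>U. \<integral>\<omega>. U \<omega> \<partial>M) ` {U. integrable M U \<and> (\<forall>\<omega>\<in>space M. f \<omega> \<le> U \<omega>)})"
    using assms(3) by (intro bdd_belowI2[of _ b] integral_ge_const) (auto intro: order_trans)
qed (use assms in auto)

lemma (in prob_space) outer_expectation_lessD:
  fixes f :: "'a \<Rightarrow> real"
  assumes "outer_expectation M f < a" and "\<And>\<omega>. \<omega> \<in> space M \<Longrightarrow> f \<omega> \<in> {b..c}"
  shows "\<exists>U. integrable M U \<and> (\<forall>\<omega>\<in>space M. f \<omega> \<le> U \<omega>) \<and> (\<integral>\<omega>. U \<omega> \<partial>M) < a"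
proof -
  have "{U. integrable M U \<and> (\<forall>\<omega>\<in>space M. f \<omega> \<le> U \<omega>)} \<noteq> {}"
    using assms(2) by (auto intro!: exI[of _ "\<lambda>_. c"])
  moreover have "bdd_below ((\<lambda>U. \<integral>\<omega>. U \<omega> \<partial>M) ` {U. integrable M U \<and> (\<forall>\<omega>\<in>space M. f \<omega> \<le> U \<omega>)})"
    using assms(2) by (intro bdd_belowI2[of _ b] integral_ge_const) (auto intro: order_trans)
  ultimately show ?thesis
    using assms(1) unfolding outer_expectation_def by (subst (asm) cINF_less_iff) auto
qed

text \<open>
  The left side is the inner expectation: measurable functions below \<open>f\<close> stay below those above it.
\<close>

lemma (in prob_space) outer_expectation_minus:
  fixes f :: "'a \<Rightarrow> real"
  assumes "\<And>\<omega>. \<omega> \<in> space M \<Longrightarrow> f \<omega> \<in> {- c..c}"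
  shows "- outer_expectation M (\<lambda>\<omega>. - f \<omega>) \<le> outer_expectation M f"
proof (rule ccontr)
  assume "\<not> ?thesis"
  then have "outer_expectation M f < - outer_expectation M (\<lambda>\<omega>. - f \<omega>)" by simp
  from outer_expectation_lessD[OF this, of "- c" c] assms obtain U where
    U: "integrable M U" "\<forall>\<omega>\<in>space M. f \<omega> \<le> U \<omega>" "(\<integral>\<omega>. U \<omega> \<partial>M) < - outer_expectation M (\<lambda>\<omega>. - f \<omega>)"
    by auto
  then have "outer_expectation M (\<lambda>\<omega>. - f \<omega>) < (\<integral>\<omega>. - U \<omega> \<partial>M)" by simp
  moreover have "\<And>\<omega>. \<omega> \<in> space M \<Longrightarrow> - f \<omega> \<in> {- c..c}" using assms by force
  ultimately obtain U' where
    U': "integrable M U'" "\<forall>\<omega>\<in>space M. - f \<omega> \<le> U' \<omega>" "(\<integral>\<omega>. U' \<omega> \<partial>M) < (\<integral>\<omega>. - U \<omega> \<partial>M)"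
    using outer_expectation_lessD by metis
  have "(\<integral>\<omega>. - U \<omega> \<partial>M) \<le> (\<integral>\<omega>. U' \<omega> \<partial>M)"
  proof (rule integral_mono)
    fix \<omega> assume "\<omega> \<in> space M"
    then have "f \<omega> \<le> U \<omega>" "- f \<omega> \<le> U' \<omega>" using U(2) U'(2) by auto
    then show "- U \<omega> \<le> U' \<omega>" by simp
  qed (use U U' in auto)
  with U'(3) show False by simp
qed

lemma (in prob_space) inner_prob_lessD:
  assumes "a < inner_prob M S"
  shows "\<exists>A \<in> sets M. A \<subseteq> S \<and> a < prob A"
proof -
  have "bdd_above (measure M ` {A \<in> sets M. A \<subseteq> S})" by (intro bdd_aboveI2[of _ _ 1]) simp
  moreover have "{A \<in> sets M. A \<subseteq> S} \<noteq> {}" by (auto intro!: exI[of _ "{}"])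
  ultimately show ?thesis using assms unfolding inner_prob_def by (subst (asm) less_cSUP_iff) auto
qed

lemma (in prob_space) inner_prob_le_1: "inner_prob M S \<le> 1"
  unfolding inner_prob_def by (rule cSUP_least) (auto intro!: exI[of _ "{}"])

text \<open>
  If an integrable majorant \<open>U\<close> of the indicator of the complement of \<open>S\<close> has small expectation, then
  \<open>U < 1\<close> is a measurable event inside \<open>S\<close>, and it is likely by Markov's inequality.
\<close>

lemma (in prob_space) inner_prob_outer_expectation:
  assumes "outer_expectation M (\<lambda>\<omega>. of_bool (\<omega> \<notin> S)) < \<epsilon>"
  shows "1 - \<epsilon> < inner_prob M {\<omega> \<in> space M. \<omega> \<in> S}"
proof -
  from outer_expectation_lessD[OF assms, of 0 1] obtain U where
    U: "integrable M U" "\<forall>\<omega>\<in>space M. of_bool (\<omega> \<notin> S) \<le> U \<omega>" "(\<integral>\<omega>. U \<omega> \<partial>M) < \<epsilon>" by auto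
  have [measurable]: "U \<in> borel_measurable M" using U(1) by auto
  have U_nonneg: "0 \<le> U \<omega>" if "\<omega> \<in> space M" for \<omega> using U(2) that by (meson of_bool_less_eq_iff order_trans zero_less_eq_of_bool)
  have "prob {\<omega> \<in> space M. 1 \<le> U \<omega>} \<le> (\<integral>\<omega>. U \<omega> \<partial>M) / 1"
    using U_nonneg by (intro integral_Markov_inequality_measure[OF U(1), of "space M"]) auto
  also have "\<dots> < \<epsilon>" using U(3) by simp
  finally have "1 - \<epsilon> < 1 - prob {\<omega> \<in> space M. 1 \<le> U \<omega>}" by simp
  also have "\<dots> = prob (space M - {\<omega> \<in> space M. 1 \<le> U \<omega>})" by (rule prob_compl[symmetric]) simp
  also have "\<dots> \<le> inner_prob M {\<omega> \<in> space M. \<omega> \<in> S}"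
    unfolding inner_prob_def
  proof (rule cSUP_upper)
    show "space M - {\<omega> \<in> space M. 1 \<le> U \<omega>} \<in> {A \<in> sets M. A \<subseteq> {\<omega> \<in> space M. \<omega> \<in> S}}"
      using U(2) by (auto simp: of_bool_def split: if_splits)
    show "bdd_above (measure M ` {A \<in> sets M. A \<subseteq> {\<omega> \<in> space M. \<omega> \<in> S}})"
      by (intro bdd_aboveI2[of _ _ 1]) simp
  qed
  finally show ?thesis .
qed

lemma liminf_ereal_gtD:
  assumes "ereal a \<le> liminf (\<lambda>n. ereal (f n))" and "b < a"
  shows "\<forall>\<^sub>F n in sequentially. b < f n"
proof -
  have "ereal b < liminf (\<lambda>n. ereal (f n))" using assms by (metis ereal_less_eq(3) less_ereal.simps(1) less_le_trans)
  from less_LiminfD[OF this] show ?thesis by simp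
qed

section \<open>The extended continuous mapping theorem\<close>

text \<open>
  Truncation turns a bound for all functions in \<open>BL1\<close> into one for bounded variables themselves.
\<close>

lemma clip_in_BL1: "(\<lambda>c::real. max (-1) (min 1 c)) \<in> BL1"
  unfolding BL1_def by (auto intro!: lipschitz_onI simp: dist_real_def)

text \<open>
  An extended continuous mapping theorem, in its one-sided form. The values \<open>Z n \<omega>\<close> already include
  the test function, which is merely continuous in the definition of weak convergence; after division
  by \<open>B\<close> the envelope lemma is used with truncation in the role of \<open>h\<close>.
\<close>

lemma weak_conv_HJ_majorant:
  fixes Y :: "nat \<Rightarrow> 'w \<Rightarrow> 'd::metric_space" and F :: "nat \<Rightarrow> ('d \<times> real) set"
  assumes M: "\<And>n. prob_space (M n)" and P: "prob_space P"
    and G: "G \<in> measurable P borel" "\<And>\<omega>. \<omega> \<in> space P \<Longrightarrow> G \<omega> \<in> D0"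
    and Y: "weak_conv_HJ M Y P G"
    and f: "continuous_on D0 f" "\<And>y. y \<in> D0 \<Longrightarrow> f y \<in> {- B..B}" and "0 < B"
    and dec: "\<And>k l. k \<le> l \<Longrightarrow> F l \<subseteq> F k"
    and conv: "\<And>y p. y \<in> D0 \<Longrightarrow> (\<And>k. p k \<in> F k) \<Longrightarrow> (\<lambda>k. fst (p k)) \<longlonglongrightarrow> y
        \<Longrightarrow> \<exists>r::nat \<Rightarrow> nat. strict_mono r \<and> (\<lambda>k. snd (p (r k))) \<longlonglongrightarrow> f y"
    and Z: "\<And>k n \<omega>. 1 \<le> k \<Longrightarrow> k \<le> n \<Longrightarrow> \<omega> \<in> space (M n) \<Longrightarrow> (Y n \<omega>, Z n \<omega>) \<in> F k"
      "\<And>n \<omega>. \<omega> \<in> space (M n) \<Longrightarrow> Z n \<omega> \<in> {- B..B}"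
    and "0 < \<epsilon>"
  shows "\<forall>\<^sub>F n in sequentially. outer_expectation (M n) (Z n) < (\<integral>\<omega>. f (G \<omega>) \<partial>P) + \<epsilon>"
proof -
  let ?clip = "\<lambda>c::real. max (-1) (min 1 c)"
  have clip: "B * ?clip (c / B) = c" if "c \<in> {- B..B}" for c
  proof -
    have "c / B \<le> 1" "- 1 \<le> c / B" using that \<open>0 < B\<close> by (auto simp: field_simps)
    then have "?clip (c / B) = c / B" by auto
    then show ?thesis using \<open>0 < B\<close> by simp
  qed
  have "\<exists>k\<ge>1. \<forall>h\<in>BL1. \<exists>u. (real k)-lipschitz_on UNIV u \<and> range u \<subseteq> {-1..1} \<and>
      (\<integral>\<omega>. u (G \<omega>) \<partial>P) \<le> (\<integral>\<omega>. h (f (G \<omega>) / B) \<partial>P) + \<epsilon> / (2 * B) \<and>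
      (\<forall>(y, c)\<in>(\<lambda>(y, c). (y, c / B)) ` F k. h c \<le> u y)"
  proof (rule lipschitz_envelope[OF P G])
    show "continuous_on D0 (\<lambda>y. f y / B)" using f(1) by (intro continuous_intros) (use \<open>0 < B\<close> in auto)
    show "(\<lambda>(y, c). (y, c / B)) ` F l \<subseteq> (\<lambda>(y, c). (y, c / B)) ` F k" if "k \<le> l" for k l
      using dec[OF that] by (rule image_mono)
    show "0 < \<epsilon> / (2 * B)" using \<open>0 < B\<close> \<open>0 < \<epsilon>\<close> by simp
    fix y p
    assume y: "y \<in> D0" and p: "\<And>k. p k \<in> (\<lambda>(y, c). (y, c / B)) ` F k" and lim: "(\<lambda>k. fst (p k)) \<longlonglongrightarrow> y"
    have "(fst (p k), snd (p k) * B) \<in> F k" for k using p[of k] \<open>0 < B\<close> by (auto simp: image_iff)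
    then have "\<exists>r::nat \<Rightarrow> nat. strict_mono r \<and> (\<lambda>k. snd (p (r k)) * B) \<longlonglongrightarrow> f y"
      using conv[OF y, of "\<lambda>k. (fst (p k), snd (p k) * B)"] lim by simp
    then obtain r :: "nat \<Rightarrow> nat" where r: "strict_mono r" "(\<lambda>k. snd (p (r k)) * B) \<longlonglongrightarrow> f y" by auto
    from tendsto_divide[OF r(2) tendsto_const[of B]] \<open>0 < B\<close>
    have "(\<lambda>k. snd (p (r k))) \<longlonglongrightarrow> f y / B" by simp
    with r(1) show "\<exists>r::nat \<Rightarrow> nat. strict_mono r \<and> (\<lambda>k. snd (p (r k))) \<longlonglongrightarrow> f y / B" by auto
  qed
  then obtain k where k: "1 \<le> k" and "\<forall>h\<in>BL1. \<exists>u. (real k)-lipschitz_on UNIV u \<and> range u \<subseteq> {-1..1} \<and>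
      (\<integral>\<omega>. u (G \<omega>) \<partial>P) \<le> (\<integral>\<omega>. h (f (G \<omega>) / B) \<partial>P) + \<epsilon> / (2 * B) \<and>
      (\<forall>(y, c)\<in>(\<lambda>(y, c). (y, c / B)) ` F k. h c \<le> u y)" by (elim exE conjE)
  from bspec[OF this(2) clip_in_BL1] obtain u where u: "(real k)-lipschitz_on UNIV u" "range u \<subseteq> {-1..1}"
      "(\<integral>\<omega>. u (G \<omega>) \<partial>P) \<le> (\<integral>\<omega>. ?clip (f (G \<omega>) / B) \<partial>P) + \<epsilon> / (2 * B)"
      and "\<forall>(y, c)\<in>(\<lambda>(y, c). (y, c / B)) ` F k. ?clip c \<le> u y"
    by (elim exE conjE)
  then have u4: "?clip (c / B) \<le> u y" if "(y, c) \<in> F k" for y c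
    using that by (force simp del: max.bounded_iff min.bounded_iff)
  have "(\<integral>\<omega>. B * u (G \<omega>) \<partial>P) = B * (\<integral>\<omega>. u (G \<omega>) \<partial>P)" by simp
  also have "\<dots> \<le> B * ((\<integral>\<omega>. ?clip (f (G \<omega>) / B) \<partial>P) + \<epsilon> / (2 * B))"
    using u(3) \<open>0 < B\<close> by (intro mult_left_mono) auto
  also have "\<dots> = (\<integral>\<omega>. B * ?clip (f (G \<omega>) / B) \<partial>P) + \<epsilon> / 2"
    using \<open>0 < B\<close> by (simp add: distrib_left)
  also have "(\<integral>\<omega>. B * ?clip (f (G \<omega>) / B) \<partial>P) = (\<integral>\<omega>. f (G \<omega>) \<partial>P)"
    using clip f(2) G(2) by (intro Bochner_Integration.integral_cong) auto
  finally have less: "(\<integral>\<omega>. B * u (G \<omega>) \<partial>P) < (\<integral>\<omega>. f (G \<omega>) \<partial>P) + \<epsilon>" using \<open>0 < \<epsilon>\<close> by simp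
  have u_range: "B * u y \<in> {- B..B}" for y
  proof -
    have "u y \<in> {-1..1}" using u(2) by (rule subsetD) simp
    then have "B * u y \<le> B * 1" "B * (- 1) \<le> B * u y"
      using \<open>0 < B\<close> by (intro mult_left_mono; simp)+
    then show ?thesis by simp
  qed
  have "continuous_on UNIV (\<lambda>y. B * u y)"
    using lipschitz_on_continuous_on[OF u(1)] by (intro continuous_intros)
  moreover have "bounded (range (\<lambda>y. B * u y))"
    using u_range by (intro boundedI[of _ B]) (auto simp: abs_le_iff minus_le_iff)
  ultimately have "(\<lambda>n. outer_expectation (M n) (\<lambda>\<omega>. B * u (Y n \<omega>))) \<longlonglongrightarrow> (\<integral>\<omega>. B * u (G \<omega>) \<partial>P)"
    using Y unfolding weak_conv_HJ_def by blast
  from order_tendstoD(2)[OF this less]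
  have "\<forall>\<^sub>F n in sequentially. outer_expectation (M n) (\<lambda>\<omega>. B * u (Y n \<omega>)) < (\<integral>\<omega>. f (G \<omega>) \<partial>P) + \<epsilon>" .
  then show ?thesis
    using eventually_ge_at_top[of k]
  proof eventually_elim
    case (elim n)
    interpret prob_space "M n" by (rule M)
    obtain U where U: "integrable (M n) U" "\<forall>\<omega>\<in>space (M n). B * u (Y n \<omega>) \<le> U \<omega>"
        "(\<integral>\<omega>. U \<omega> \<partial>(M n)) < (\<integral>\<omega>. f (G \<omega>) \<partial>P) + \<epsilon>"
      using outer_expectation_lessD[OF elim(1) u_range] by auto
    have "outer_expectation (M n) (Z n) \<le> (\<integral>\<omega>. U \<omega> \<partial>(M n))"
    proof (rule outer_expectation_le[OF U(1)])
      fix \<omega> assume \<omega>: "\<omega> \<in> space (M n)"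
      have "Z n \<omega> = B * ?clip (Z n \<omega> / B)" using clip[OF Z(2)[OF \<omega>]] by simp
      also have "\<dots> \<le> B * u (Y n \<omega>)"
        using u4[OF Z(1)[OF k elim(2) \<omega>]] \<open>0 < B\<close> by (intro mult_left_mono) auto
      also have "\<dots> \<le> U \<omega>" using U(2) \<omega> by auto
      finally show "Z n \<omega> \<le> U \<omega>" .
      show "- B \<le> Z n \<omega>" using Z(2)[OF \<omega>] by simp
    qed
    with U(3) show ?case by simp
  qed
qed

section \<open>Least measurable majorants\<close>

text \<open>
  The infimum of a sequence of measurable majorants whose expectations approach the smallest possible
  value is itself a majorant and attains that value. No measurable majorant can then be smaller on a
  set of positive probability, since the minimum of both would have a smaller expectation.
\<close>

lemma (in prob_space) least_measurable_majorant_exists: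
  fixes f :: "'a \<Rightarrow> real"
  assumes f: "\<And>\<omega>. \<omega> \<in> space M \<Longrightarrow> f \<omega> \<in> {-1..1}"
  shows "\<exists>g. least_measurable_majorant M f g \<and> (\<forall>\<omega>\<in>space M. g \<omega> \<le> 1)"
proof -
  define \<U> where "\<U> = {U \<in> borel_measurable M. \<forall>\<omega>\<in>space M. f \<omega> \<le> U \<omega> \<and> U \<omega> \<le> 1}"
  define I where "I = (INF U\<in>\<U>. \<integral>\<omega>. U \<omega> \<partial>M)"
  have U_range: "U \<omega> \<in> {-1..1}" if "U \<in> \<U>" "\<omega> \<in> space M" for U \<omega>
    using f[OF that(2)] that by (force simp: \<U>_def)
  have U_int: "integrable M U" if "U \<in> \<U>" for U
    using that U_range[OF that] by (intro integrable_in_interval[where c=1]) (auto simp: \<U>_def)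
  have ne: "\<U> \<noteq> {}" using f by (auto simp: \<U>_def intro!: exI[of _ "\<lambda>_. 1"])
  have bdd: "bdd_below ((\<lambda>U. \<integral>\<omega>. U \<omega> \<partial>M) ` \<U>)"
    using U_range U_int by (intro bdd_belowI2[of _ "-1"] integral_ge_const) auto
  have "\<exists>U\<in>\<U>. (\<integral>\<omega>. U \<omega> \<partial>M) < I + 1 / real (Suc n)" for n
  proof -
    have "I < I + 1 / real (Suc n)" by simp
    then show ?thesis unfolding I_def by (subst (asm) cINF_less_iff[OF ne bdd])
  qed
  then obtain U where U: "\<And>n::nat. U n \<in> \<U>" "\<And>n. (\<integral>\<omega>. U n \<omega> \<partial>M) < I + 1 / real (Suc n)" by metis
  define g where "g \<omega> = (INF n. U n \<omega>)" for \<omega>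
  have g_le: "g \<omega> \<le> U n \<omega>" if "\<omega> \<in> space M" for n \<omega>
    unfolding g_def using U_range[OF U(1) that] by (intro cINF_lower bdd_belowI2[of _ "-1"]) auto
  have g: "g \<in> \<U>"
  proof -
    have "g \<in> borel_measurable M"
      unfolding g_def using U(1) by (intro borel_measurable_cINF_real) (auto simp: \<U>_def)
    moreover have "f \<omega> \<le> g \<omega>" if "\<omega> \<in> space M" for \<omega>
      unfolding g_def using U(1) that by (intro cINF_greatest) (auto simp: \<U>_def)
    moreover have "g \<omega> \<le> 1" if "\<omega> \<in> space M" for \<omega>
      using g_le[OF that] U_range[OF U(1) that] by (meson atLeastAtMost_iff order_trans)
    ultimately show ?thesis by (simp add: \<U>_def)
  qed
  have g_min: "(\<integral>\<omega>. g \<omega> \<partial>M) \<le> I"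
  proof (rule field_le_epsilon)
    fix e :: real assume "0 < e"
    then obtain n where n: "inverse (real (Suc n)) < e" using reals_Archimedean by blast
    have "(\<integral>\<omega>. g \<omega> \<partial>M) \<le> (\<integral>\<omega>. U n \<omega> \<partial>M)"
      using g_le by (intro integral_mono U_int g U(1))
    with U(2)[of n] n show "(\<integral>\<omega>. g \<omega> \<partial>M) \<le> I + e" by (simp add: inverse_eq_divide)
  qed
  have "AE \<omega> in M. g \<omega> \<le> V \<omega>" if V: "V \<in> borel_measurable M" "AE \<omega> in M. f \<omega> \<le> V \<omega>" for V
  proof -
    from V(2) obtain N where N: "{\<omega> \<in> space M. \<not> f \<omega> \<le> V \<omega>} \<subseteq> N" "emeasure M N = 0" "N \<in> sets M"
      by (rule AE_E)
    \<comment> \<open>An almost sure majorant becomes a majorant everywhere after replacing it by \<open>g\<close> on a null set.\<close>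
    define V' where "V' \<omega> = (if \<omega> \<in> N then g \<omega> else min (g \<omega>) (V \<omega>))" for \<omega>
    have gm: "g \<in> borel_measurable M" using g by (simp add: \<U>_def)
    have V': "V' \<in> \<U>"
    proof -
      have "V' \<in> borel_measurable M"
        unfolding V'_def using N(3) V(1) gm by (intro measurable_If_set) auto
      then show ?thesis using g N(1) by (auto simp: \<U>_def V'_def min_def)
    qed
    have "I \<le> (\<integral>\<omega>. V' \<omega> \<partial>M)" unfolding I_def by (rule cINF_lower[OF bdd V'])
    moreover have "(\<integral>\<omega>. V' \<omega> \<partial>M) \<le> (\<integral>\<omega>. g \<omega> \<partial>M)"
      by (intro integral_mono U_int g V') (auto simp: V'_def)
    ultimately have eq: "(\<integral>\<omega>. V' \<omega> \<partial>M) = (\<integral>\<omega>. g \<omega> \<partial>M)" using g_min by simp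
    have "AE \<omega> in M. V' \<omega> = g \<omega>"
      by (rule integral_ineq_eq_0_then_AE[OF _ U_int[OF V'] U_int[OF g] eq]) (auto simp: V'_def)
    moreover have "AE \<omega> in M. \<omega> \<notin> N" using N by (intro AE_not_in) auto
    ultimately show ?thesis by eventually_elim (auto simp: V'_def)
  qed
  with g show ?thesis unfolding least_measurable_majorant_def \<U>_def by (intro exI[of _ g]) auto
qed

text \<open>
  A least measurable majorant may be improved, on a null set, by any other measurable majorant. This
  freedom allows all the versions below to satisfy explicit bounds at every sample point.
\<close>

lemma least_measurable_majorant_min:
  assumes "least_measurable_majorant M f g" and "U \<in> borel_measurable M"
    and "\<And>\<omega>. \<omega> \<in> space M \<Longrightarrow> f \<omega> \<le> U \<omega>"
  shows "least_measurable_majorant M f (\<lambda>\<omega>. min (g \<omega>) (U \<omega>))"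
  unfolding least_measurable_majorant_def
proof (intro conjI ballI impI)
  show "(\<lambda>\<omega>. min (g \<omega>) (U \<omega>)) \<in> borel_measurable M"
    using assms(1,2) by (auto simp: least_measurable_majorant_def)
  fix W assume "W \<in> borel_measurable M" "AE \<omega> in M. f \<omega> \<le> W \<omega>"
  then have "AE \<omega> in M. g \<omega> \<le> W \<omega>" using assms(1) by (auto simp: least_measurable_majorant_def)
  then show "AE \<omega> in M. min (g \<omega>) (U \<omega>) \<le> W \<omega>" by eventually_elim auto
qed (use assms in \<open>auto simp: least_measurable_majorant_def\<close>)

section \<open>Transfer of conditional weak convergence\<close>

lemma prob_space_obs_space: "prob_space H \<Longrightarrow> prob_space (obs_space H n)"
  unfolding obs_space_def by (rule prob_space_PiM)

lemma prob_space_boot_space: "prob_space H \<Longrightarrow> prob_space Q \<Longrightarrow> prob_space (boot_space H Q n)"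
  unfolding boot_space_def by (intro prob_space_pair prob_space_obs_space)

lemma space_boot_space: "space (boot_space H Q n) = space (obs_space H n) \<times> space Q"
  by (simp add: boot_space_def space_pair_measure)

text \<open>
  If \<open>h(T) \<le> u(Y)\<close> on an event \<open>A n i\<close>, where \<open>u\<close> is \<open>L\<close>-Lipschitz, then \<open>L\<close> times the given version
  of the majorant of \<open>(u / L)(Y)\<close> majorizes \<open>h(T)\<close> there, and its conditional expectation exceeds
  \<open>E u(G)\<close> by at most \<open>L * \<Delta>\<close>. The versions for \<open>h(T)\<close> lie below these majorants for all \<open>i \<le> n\<close>; the
  number of levels grows with \<open>n\<close>, so that every accuracy \<open>e i\<close> is available in the limit, while each
  minimum remains one of finitely many measurable functions. A conditional expectation is bounded below by
  applying the upper bound to \<open>- h\<close>, because the majorants of \<open>h(T)\<close> and \<open>- h(T)\<close> have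
  a nonnegative sum.
\<close>

lemma cond_weak_conv_transfer:
  fixes Y :: "nat \<Rightarrow> (nat \<Rightarrow> 'x) \<times> 'z \<Rightarrow> 'm::metric_space" and T :: "nat \<Rightarrow> (nat \<Rightarrow> 'x) \<times> 'z \<Rightarrow> 'l::metric_space"
    and u :: "nat \<Rightarrow> ('l \<Rightarrow> real) \<Rightarrow> 'm \<Rightarrow> real"
  assumes H: "prob_space H" and Q: "prob_space Q" and P: "prob_space P"
    and V: "majorant_versions H Q Y V"
    and \<Delta>: "outer_majorized H (\<lambda>n. cond_BL_dist Q (V n) P G) \<Delta>"
    and A: "\<And>n i. A n i \<in> sets (obs_space H n)"
    and L: "\<And>i. 1 \<le> L i"
    and u: "\<And>i h. h \<in> BL1 \<Longrightarrow> (L i)-lipschitz_on UNIV (u i h)"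
      "\<And>i h. h \<in> BL1 \<Longrightarrow> range (u i h) \<subseteq> {-1..1}"
      "\<And>i h. h \<in> BL1 \<Longrightarrow> (\<integral>\<omega>. u i h (G \<omega>) \<partial>P) \<le> (\<integral>\<omega>. h (G' \<omega>) \<partial>P) + e i"
    and T: "\<And>n i x z h. h \<in> BL1 \<Longrightarrow> x \<in> A n i \<Longrightarrow> z \<in> space Q \<Longrightarrow> h (T n (x, z)) \<le> u i h (Y n (x, z))"
  shows "\<exists>V' \<Delta>'. majorant_versions H Q T V' \<and> outer_majorized H (\<lambda>n. cond_BL_dist Q (V' n) P G') \<Delta>' \<and>
      (\<forall>n i x. i \<le> n \<longrightarrow> x \<in> A n i \<longrightarrow> 0 \<le> \<Delta>' n x \<and> \<Delta>' n x \<le> e i + L i * \<Delta> n x)"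
proof -
  interpret Q: prob_space Q by (rule Q)
  interpret P: prob_space P by (rule P)
  have A_space: "x \<in> space (obs_space H n)" if "x \<in> A n i" for x n i
    using sets.sets_into_space[OF A] that by auto
  have sect: "(\<lambda>z. v (x, z)) \<in> borel_measurable Q"
    if "v \<in> borel_measurable (boot_space H Q n)" "x \<in> space (obs_space H n)" for v :: "_ \<Rightarrow> real" and x n
    using measurable_compose[OF measurable_Pair1'[OF that(2)] that(1)[unfolded boot_space_def]] .
  have V_lmm: "least_measurable_majorant (boot_space H Q n) (\<lambda>\<omega>. h (Y n \<omega>)) (V n h)"
    and V_le: "\<And>\<omega>. \<omega> \<in> space (boot_space H Q n) \<Longrightarrow> V n h \<omega> \<le> 1" if "h \<in> BL1" for n h
    using V that by (auto simp: majorant_versions_def)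
  have V_meas: "V n h \<in> borel_measurable (boot_space H Q n)"
    and V_ge: "\<And>\<omega>. \<omega> \<in> space (boot_space H Q n) \<Longrightarrow> h (Y n \<omega>) \<le> V n h \<omega>" if "h \<in> BL1" for n h
    using V_lmm[OF that] by (auto simp: least_measurable_majorant_def)
  define s where "s i h y = u i h y / L i" for i h y
  have s: "s i h \<in> BL1" if h: "h \<in> BL1" for i h
  proof -
    have "(1 / L i * L i)-lipschitz_on UNIV (\<lambda>y. 1 / L i * u i h y)"
      using L[of i] by (intro lipschitz_on_cmult_real_nonneg u(1) h) auto
    moreover have "s i h y \<in> {-1..1}" for y
    proof -
      have "u i h y \<in> {-1..1}" using u(2)[OF h, of i] by (rule subsetD) simp
      then show ?thesis using L[of i] by (auto simp: s_def field_simps)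
    qed
    ultimately show ?thesis using L[of i] unfolding BL1_def s_def by (auto simp: mult.commute)
  qed
  have "\<exists>g. h \<in> BL1 \<longrightarrow> least_measurable_majorant (boot_space H Q n) (\<lambda>\<omega>. h (T n \<omega>)) g \<and>
      (\<forall>\<omega>\<in>space (boot_space H Q n). g \<omega> \<le> 1)" for n h
    using prob_space.least_measurable_majorant_exists[OF prob_space_boot_space[OF H Q], where f="\<lambda>\<omega>. h (T n \<omega>)"]
      BL1_D(1)[of h] by (cases "h \<in> BL1") simp_all
  then obtain W where "\<And>n h. h \<in> BL1 \<longrightarrow> least_measurable_majorant (boot_space H Q n) (\<lambda>\<omega>. h (T n \<omega>)) (W n h) \<and>
      (\<forall>\<omega>\<in>space (boot_space H Q n). W n h \<omega> \<le> 1)"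
    by atomize_elim (intro choice allI, simp)
  then have W: "\<And>n h. h \<in> BL1 \<Longrightarrow> least_measurable_majorant (boot_space H Q n) (\<lambda>\<omega>. h (T n \<omega>)) (W n h)"
      "\<And>n h \<omega>. h \<in> BL1 \<Longrightarrow> \<omega> \<in> space (boot_space H Q n) \<Longrightarrow> W n h \<omega> \<le> 1"
    by simp_all
  define m where "m n h i \<omega> = (if fst \<omega> \<in> A n i then L i * V n (s i h) \<omega> else 1)" for n h i \<omega>
  define V' where "V' n h \<omega> = min (W n h \<omega>) (MIN i\<in>{..n}. m n h i \<omega>)" for n h \<omega>
  have m_meas: "m n h i \<in> borel_measurable (boot_space H Q n)" if "h \<in> BL1" for n h i
  proof -
    have [measurable]: "A n i \<in> sets (obs_space H n)" by (rule A)
    have [measurable]: "V n (s i h) \<in> borel_measurable (obs_space H n \<Otimes>\<^sub>M Q)"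
      using V_meas[OF s[OF that]] by (simp add: boot_space_def)
    show ?thesis unfolding m_def boot_space_def by measurable
  qed
  have m_ge: "h (T n \<omega>) \<le> m n h i \<omega>" if h: "h \<in> BL1" and \<omega>: "\<omega> \<in> space (boot_space H Q n)" for n h i \<omega>
  proof (cases "fst \<omega> \<in> A n i")
    case True
    have "h (T n \<omega>) \<le> u i h (Y n \<omega>)"
      using T[OF h True, of "snd \<omega>"] \<omega> by (auto simp: space_boot_space)
    also have "\<dots> = L i * s i h (Y n \<omega>)" using L[of i] by (simp add: s_def)
    also have "\<dots> \<le> L i * V n (s i h) \<omega>"
      using L[of i] V_ge[OF s[OF h] \<omega>] by (intro mult_left_mono) auto
    finally show ?thesis using True by (simp add: m_def)
  next
    case False
    then show ?thesis using BL1_D(1)[OF h, of "T n \<omega>"] by (simp add: m_def)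
  qed
  have V'_lmm: "least_measurable_majorant (boot_space H Q n) (\<lambda>\<omega>. h (T n \<omega>)) (V' n h)" if h: "h \<in> BL1" for n h
    unfolding V'_def
  proof (rule least_measurable_majorant_min[OF W(1)[OF h]])
    show "(\<lambda>\<omega>. MIN i\<in>{..n}. m n h i \<omega>) \<in> borel_measurable (boot_space H Q n)"
      by (intro borel_measurable_Min m_meas h) simp
  qed (use m_ge[OF h] in auto)
  have V'_le: "V' n h \<omega> \<le> 1" if "h \<in> BL1" "\<omega> \<in> space (boot_space H Q n)" for n h \<omega>
    using W(2)[OF that] by (auto simp: V'_def)
  have V'_ge: "h (T n \<omega>) \<le> V' n h \<omega>" if "h \<in> BL1" "\<omega> \<in> space (boot_space H Q n)" for n h \<omega>
    using V'_lmm[OF that(1)] that(2) by (auto simp: least_measurable_majorant_def)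
  have V'_int: "integrable Q (\<lambda>z. V' n h (x, z))" if h: "h \<in> BL1" and x: "x \<in> space (obs_space H n)" for n h x
  proof (rule Q.integrable_in_interval[where c=1])
    show "(\<lambda>z. V' n h (x, z)) \<in> borel_measurable Q"
      using V'_lmm[OF h] x by (intro sect) (auto simp: least_measurable_majorant_def)
    fix z assume "z \<in> space Q"
    then have "(x, z) \<in> space (boot_space H Q n)" using x by (simp add: space_boot_space)
    from V'_le[OF h this] V'_ge[OF h this] BL1_D(1)[OF h, of "T n (x, z)"]
    show "V' n h (x, z) \<in> {-1..1}" by auto
  qed
  have V_abs: "\<bar>\<integral>z. V n h (x, z) \<partial>Q\<bar> \<le> 1" if h: "h \<in> BL1" and x: "x \<in> space (obs_space H n)" for n h x
  proof (rule Q.abs_integral_le)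
    fix z assume "z \<in> space Q"
    then have "(x, z) \<in> space (boot_space H Q n)" using x by (simp add: space_boot_space)
    from V_le[OF h this] V_ge[OF h this] BL1_D(1)[OF h, of "Y n (x, z)"]
    show "V n h (x, z) \<in> {-1..1}" by auto
  qed
  have V'_abs: "\<bar>\<integral>z. V' n h (x, z) \<partial>Q\<bar> \<le> 1" if h: "h \<in> BL1" and x: "x \<in> space (obs_space H n)" for n h x
  proof (rule Q.abs_integral_le)
    fix z assume "z \<in> space Q"
    then have "(x, z) \<in> space (boot_space H Q n)" using x by (simp add: space_boot_space)
    from V'_le[OF h this] V'_ge[OF h this] BL1_D(1)[OF h, of "T n (x, z)"]
    show "V' n h (x, z) \<in> {-1..1}" by auto
  qed
  have V_dist: "\<bar>(\<integral>z. V n h (x, z) \<partial>Q) - (\<integral>\<omega>. h (G \<omega>) \<partial>P)\<bar> \<le> \<Delta> n x"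
    if h: "h \<in> BL1" and x: "x \<in> space (obs_space H n)" for n h x
  proof -
    have "\<bar>(\<integral>z. V n h' (x, z) \<partial>Q) - (\<integral>\<omega>. h' (G \<omega>) \<partial>P)\<bar> \<le> 2" if h': "h' \<in> BL1" for h'
    proof -
      have "\<bar>\<integral>\<omega>. h' (G \<omega>) \<partial>P\<bar> \<le> 1" using BL1_D(1)[OF h'] by (intro P.abs_integral_le)
      with V_abs[OF h' x] show ?thesis by linarith
    qed
    then have "bdd_above ((\<lambda>h'. \<bar>(\<integral>z. V n h' (x, z) \<partial>Q) - (\<integral>\<omega>. h' (G \<omega>) \<partial>P)\<bar>) ` BL1)"
      by (intro bdd_aboveI2)
    then have "\<bar>(\<integral>z. V n h (x, z) \<partial>Q) - (\<integral>\<omega>. h (G \<omega>) \<partial>P)\<bar> \<le> cond_BL_dist Q (V n) P G x"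
      unfolding cond_BL_dist_def by (rule cSUP_upper[OF h])
    also have "\<dots> \<le> \<Delta> n x" using \<Delta> x by (simp add: outer_majorized_def)
    finally show ?thesis .
  qed
  have V'_upper: "(\<integral>z. V' n h (x, z) \<partial>Q) \<le> (\<integral>\<omega>. h (G' \<omega>) \<partial>P) + (e i + L i * \<Delta> n x)"
    if h: "h \<in> BL1" and i: "i \<le> n" and x: "x \<in> A n i" for n h i x
  proof -
    have x': "x \<in> space (obs_space H n)" using A_space[OF x] .
    have V_int: "integrable Q (\<lambda>z. V n (s i h) (x, z))"
    proof (rule Q.integrable_in_interval[where c=1])
      show "(\<lambda>z. V n (s i h) (x, z)) \<in> borel_measurable Q" by (rule sect[OF V_meas[OF s[OF h]] x'])
      fix z assume "z \<in> space Q"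
      then have "(x, z) \<in> space (boot_space H Q n)" using x' by (simp add: space_boot_space)
      from V_le[OF s[OF h] this] V_ge[OF s[OF h] this] BL1_D(1)[OF s[OF h], of _ "Y n (x, z)"]
      show "V n (s i h) (x, z) \<in> {-1..1}" by (auto intro: order_trans)
    qed
    have "(\<integral>z. V' n h (x, z) \<partial>Q) \<le> (\<integral>z. L i * V n (s i h) (x, z) \<partial>Q)"
    proof (rule integral_mono[OF V'_int[OF h x']])
      show "integrable Q (\<lambda>z. L i * V n (s i h) (x, z))" using V_int by simp
      fix z assume "z \<in> space Q"
      have "V' n h (x, z) \<le> m n h i (x, z)"
        unfolding V'_def using i by (intro min.coboundedI2 Min_le) auto
      then show "V' n h (x, z) \<le> L i * V n (s i h) (x, z)" using x by (simp add: m_def)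
    qed
    also have "\<dots> = L i * (\<integral>z. V n (s i h) (x, z) \<partial>Q)" by simp
    also have "\<dots> \<le> L i * ((\<integral>\<omega>. s i h (G \<omega>) \<partial>P) + \<Delta> n x)"
      using V_dist[OF s[OF h, of i] x'] L[of i] by (intro mult_left_mono) (auto simp: abs_le_iff)
    also have "\<dots> = (\<integral>\<omega>. u i h (G \<omega>) \<partial>P) + L i * \<Delta> n x"
      using L[of i] by (simp add: s_def distrib_left)
    also have "\<dots> \<le> (\<integral>\<omega>. h (G' \<omega>) \<partial>P) + (e i + L i * \<Delta> n x)" using u(3)[OF h, of i] by simp
    finally show ?thesis .
  qed
  \<comment> \<open>An upper bound for all \<open>h\<close> is also a lower bound, by \<open>- V' (- h) \<le> V' h\<close>.\<close>
  have V'_dist: "\<bar>(\<integral>z. V' n h (x, z) \<partial>Q) - (\<integral>\<omega>. h (G' \<omega>) \<partial>P)\<bar> \<le> b"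
    if h: "h \<in> BL1" and x: "x \<in> space (obs_space H n)"
      and b: "\<And>h. h \<in> BL1 \<Longrightarrow> (\<integral>z. V' n h (x, z) \<partial>Q) \<le> (\<integral>\<omega>. h (G' \<omega>) \<partial>P) + b" for n h x b
  proof -
    have h': "(\<lambda>t. - h t) \<in> BL1" using h by (auto simp: BL1_def)
    have "(\<integral>z. - V' n (\<lambda>t. - h t) (x, z) \<partial>Q) \<le> (\<integral>z. V' n h (x, z) \<partial>Q)"
    proof (rule integral_mono)
      fix z assume "z \<in> space Q"
      then have "(x, z) \<in> space (boot_space H Q n)" using x by (simp add: space_boot_space)
      from V'_ge[OF h this] V'_ge[OF h' this]
      show "- V' n (\<lambda>t. - h t) (x, z) \<le> V' n h (x, z)" by simp
    qed (use V'_int[OF h x] V'_int[OF h' x] in auto)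
    with b[OF h] b[OF h'] show ?thesis by simp
  qed
  \<comment> \<open>The constant 2 is the trivial bound for the distance of two expectations of a function in \<open>BL1\<close>.\<close>
  define \<Delta>' where "\<Delta>' n x = min 2 (MIN i\<in>{..n}. if x \<in> A n i then e i + L i * \<Delta> n x else 2)" for n x
  have BL1_ne: "(BL1 :: ('l \<Rightarrow> real) set) \<noteq> {}"
    by (auto simp: BL1_def intro!: exI[of _ "\<lambda>_. 0"] lipschitz_onI)
  have bound: "cond_BL_dist Q (V' n) P G' x \<le> \<Delta>' n x" if x: "x \<in> space (obs_space H n)" for n x
    unfolding cond_BL_dist_def
  proof (rule cSUP_least[OF BL1_ne], rule V'_dist[OF _ x])
    fix h :: "'l \<Rightarrow> real" assume h: "h \<in> BL1"
    have "\<bar>\<integral>\<omega>. h (G' \<omega>) \<partial>P\<bar> \<le> 1" using BL1_D(1)[OF h] by (intro P.abs_integral_le)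
    then have "(\<integral>z. V' n h (x, z) \<partial>Q) - (\<integral>\<omega>. h (G' \<omega>) \<partial>P) \<le> 2" using V'_abs[OF h x] by linarith
    moreover have "(\<integral>z. V' n h (x, z) \<partial>Q) - (\<integral>\<omega>. h (G' \<omega>) \<partial>P) \<le> e i + L i * \<Delta> n x"
      if "i \<le> n" "x \<in> A n i" for i using V'_upper[OF h that] by simp
    ultimately have "(\<integral>z. V' n h (x, z) \<partial>Q) - (\<integral>\<omega>. h (G' \<omega>) \<partial>P) \<le> \<Delta>' n x"
      unfolding \<Delta>'_def by (intro min.boundedI Min.boundedI) auto
    then show "(\<integral>z. V' n h (x, z) \<partial>Q) \<le> (\<integral>\<omega>. h (G' \<omega>) \<partial>P) + \<Delta>' n x" by simp
  qed auto
  have dist_nonneg: "0 \<le> cond_BL_dist Q (V' n) P G' x" if x: "x \<in> space (obs_space H n)" for n x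
  proof -
    obtain h :: "'l \<Rightarrow> real" where h: "h \<in> BL1" using BL1_ne by auto
    have "\<bar>(\<integral>z. V' n h (x, z) \<partial>Q) - (\<integral>\<omega>. h (G' \<omega>) \<partial>P)\<bar> \<le> 2" if h: "h \<in> BL1" for h
    proof -
      have "\<bar>\<integral>\<omega>. h (G' \<omega>) \<partial>P\<bar> \<le> 1" using BL1_D(1)[OF h] by (intro P.abs_integral_le)
      with V'_abs[OF h x] show ?thesis by linarith
    qed
    then have "bdd_above ((\<lambda>h. \<bar>(\<integral>z. V' n h (x, z) \<partial>Q) - (\<integral>\<omega>. h (G' \<omega>) \<partial>P)\<bar>) ` BL1)"
      by (intro bdd_aboveI2)
    then show ?thesis unfolding cond_BL_dist_def by (intro cSUP_upper2[OF _ h]) auto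
  qed
  have "\<Delta>' n \<in> borel_measurable (obs_space H n)" for n
  proof -
    have [measurable]: "\<And>i. A n i \<in> sets (obs_space H n)" by (rule A)
    have [measurable]: "\<Delta> n \<in> borel_measurable (obs_space H n)" using \<Delta> by (simp add: outer_majorized_def)
    show ?thesis unfolding \<Delta>'_def by measurable
  qed
  then have "outer_majorized H (\<lambda>n. cond_BL_dist Q (V' n) P G') \<Delta>'"
    using bound by (simp add: outer_majorized_def)
  moreover have "majorant_versions H Q T V'" using V'_lmm V'_le by (simp add: majorant_versions_def)
  moreover have "0 \<le> \<Delta>' n x \<and> \<Delta>' n x \<le> e i + L i * \<Delta> n x" if "i \<le> n" "x \<in> A n i" for n i x
  proof
    show "0 \<le> \<Delta>' n x" using dist_nonneg bound A_space[OF that(2)] order_trans by blast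
    have "\<Delta>' n x \<le> (if x \<in> A n i then e i + L i * \<Delta> n x else 2)"
      unfolding \<Delta>'_def using that by (intro min.coboundedI2 Min_le) auto
    then show "\<Delta>' n x \<le> e i + L i * \<Delta> n x" using that by simp
  qed
  ultimately show ?thesis by blast
qed

text \<open>
  The inequality between functions to which the bootstrap part is reduced: on the events \<open>A n\<close> the
  statistic \<open>T\<close> is controlled from above by \<open>Y\<close>, with one Lipschitz constant and the same loss \<open>\<epsilon>\<close> for
  all test functions.
\<close>

definition lipschitz_dominated ::
  "'z measure \<Rightarrow> 'p measure \<Rightarrow> (nat \<Rightarrow> (nat \<Rightarrow> 'x) \<times> 'z \<Rightarrow> 'm::metric_space) \<Rightarrow> ('p \<Rightarrow> 'm)
    \<Rightarrow> (nat \<Rightarrow> (nat \<Rightarrow> 'x) \<times> 'z \<Rightarrow> 'l::metric_space) \<Rightarrow> ('p \<Rightarrow> 'l) \<Rightarrow> (nat \<Rightarrow> (nat \<Rightarrow> 'x) set) \<Rightarrow> real \<Rightarrow> bool" where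
  "lipschitz_dominated Q P Y G T G' A \<epsilon> \<longleftrightarrow>
     (\<exists>L u. 1 \<le> L \<and> (\<forall>h\<in>BL1. L-lipschitz_on UNIV (u h) \<and> range (u h) \<subseteq> {-1..1} \<and>
        (\<integral>\<omega>. u h (G \<omega>) \<partial>P) \<le> (\<integral>\<omega>. h (G' \<omega>) \<partial>P) + \<epsilon> \<and>
        (\<forall>n. \<forall>x\<in>A n. \<forall>z\<in>space Q. h (T n (x, z)) \<le> u h (Y n (x, z)))))"

text \<open>
  The domination property at the levels \<open>i = 0, 1, \<dots>\<close>, with its Lipschitz constants and envelopes made
  explicit so that they can be used simultaneously.
\<close>

lemma cond_weak_conv_transfer_dominated:
  fixes A :: "nat \<Rightarrow> nat \<Rightarrow> (nat \<Rightarrow> 'x) set"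
  assumes H: "prob_space H" and Q: "prob_space Q" and P: "prob_space P"
    and V: "majorant_versions H Q Y V"
    and \<Delta>: "outer_majorized H (\<lambda>n. cond_BL_dist Q (V n) P G) \<Delta>"
    and A: "\<And>i n. A i n \<in> sets (obs_space H n)"
    and dom: "\<And>i. lipschitz_dominated Q P Y G T G' (A i) (e i)"
  shows "\<exists>V' \<Delta>' L. majorant_versions H Q T V' \<and> outer_majorized H (\<lambda>n. cond_BL_dist Q (V' n) P G') \<Delta>' \<and>
      (\<forall>i. 1 \<le> L i) \<and>
      (\<forall>n i x. i \<le> n \<longrightarrow> x \<in> A i n \<longrightarrow> 0 \<le> \<Delta>' n x \<and> \<Delta>' n x \<le> e i + L i * \<Delta> n x)"
proof -
  have "\<forall>i. \<exists>L u. 1 \<le> L \<and> (\<forall>h\<in>BL1. (L)-lipschitz_on UNIV (u h) \<and> range (u h) \<subseteq> {-1..1} \<and>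
        (\<integral>\<omega>. u h (G \<omega>) \<partial>P) \<le> (\<integral>\<omega>. h (G' \<omega>) \<partial>P) + e i \<and>
        (\<forall>n. \<forall>x\<in>A i n. \<forall>z\<in>space Q. h (T n (x, z)) \<le> u h (Y n (x, z))))"
    using dom unfolding lipschitz_dominated_def by (rule allI)
  from choice[OF this] obtain L where "\<forall>i. \<exists>u. 1 \<le> L i \<and> (\<forall>h\<in>BL1. (L i)-lipschitz_on UNIV (u h) \<and> range (u h) \<subseteq> {-1..1} \<and>
        (\<integral>\<omega>. u h (G \<omega>) \<partial>P) \<le> (\<integral>\<omega>. h (G' \<omega>) \<partial>P) + e i \<and>
        (\<forall>n. \<forall>x\<in>A i n. \<forall>z\<in>space Q. h (T n (x, z)) \<le> u h (Y n (x, z))))" ..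
  from choice[OF this] obtain u where Lu: "\<forall>i. 1 \<le> L i \<and> (\<forall>h\<in>BL1. (L i)-lipschitz_on UNIV (u i h) \<and> range (u i h) \<subseteq> {-1..1} \<and>
        (\<integral>\<omega>. u i h (G \<omega>) \<partial>P) \<le> (\<integral>\<omega>. h (G' \<omega>) \<partial>P) + e i \<and>
        (\<forall>n. \<forall>x\<in>A i n. \<forall>z\<in>space Q. h (T n (x, z)) \<le> u i h (Y n (x, z))))" ..
  then have L: "1 \<le> L i" for i by simp
  have u: "\<And>i h. h \<in> BL1 \<Longrightarrow> (L i)-lipschitz_on UNIV (u i h)"
      "\<And>i h. h \<in> BL1 \<Longrightarrow> range (u i h) \<subseteq> {-1..1}"
      "\<And>i h. h \<in> BL1 \<Longrightarrow> (\<integral>\<omega>. u i h (G \<omega>) \<partial>P) \<le> (\<integral>\<omega>. h (G' \<omega>) \<partial>P) + e i"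
      "\<And>n i x z h. h \<in> BL1 \<Longrightarrow> x \<in> A i n \<Longrightarrow> z \<in> space Q \<Longrightarrow> h (T n (x, z)) \<le> u i h (Y n (x, z))"
    using Lu by simp_all
  have "\<exists>V' \<Delta>'. majorant_versions H Q T V' \<and> outer_majorized H (\<lambda>n. cond_BL_dist Q (V' n) P G') \<Delta>' \<and>
      (\<forall>n i x. i \<le> n \<longrightarrow> x \<in> A i n \<longrightarrow> 0 \<le> \<Delta>' n x \<and> \<Delta>' n x \<le> e i + L i * \<Delta> n x)"
    by (rule cond_weak_conv_transfer[OF H Q P V \<Delta>, where A="\<lambda>n i. A i n" and u=u]) (fact A L u)+
  then obtain V' \<Delta>' where "majorant_versions H Q T V'"
      "outer_majorized H (\<lambda>n. cond_BL_dist Q (V' n) P G') \<Delta>'"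
      "\<forall>n i x. i \<le> n \<longrightarrow> x \<in> A i n \<longrightarrow> 0 \<le> \<Delta>' n x \<and> \<Delta>' n x \<le> e i + L i * \<Delta> n x"
    by (elim exE conjE)
  moreover have "\<forall>i. 1 \<le> L i" using L by simp
  ultimately show ?thesis by (intro exI[of _ V'] exI[of _ \<Delta>'] exI[of _ L] conjI)
qed

text \<open>
  Domination with loss \<open>e i\<close> bounds the distance for \<open>T\<close> by \<open>e i + L i * \<Delta> n\<close> on \<open>A i n\<close>. For fixed \<open>i\<close>
  the second term tends to 0 in probability, and the complement of \<open>A i n\<close> has probability at most
  \<open>e i\<close> for large \<open>n\<close>; then \<open>i\<close> is taken large.
\<close>

lemma cond_weak_conv_prob_transfer:
  fixes Y :: "nat \<Rightarrow> (nat \<Rightarrow> 'x) \<times> 'z \<Rightarrow> 'm::metric_space" and T :: "nat \<Rightarrow> (nat \<Rightarrow> 'x) \<times> 'z \<Rightarrow> 'l::metric_space"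
  assumes H: "prob_space H" and Q: "prob_space Q" and P: "prob_space P"
    and Y: "cond_weak_conv_prob H Q Y P G"
    and dom: "\<And>\<epsilon>. 0 < \<epsilon> \<Longrightarrow> \<exists>A. (\<forall>n. A n \<in> sets (obs_space H n)) \<and> lipschitz_dominated Q P Y G T G' A \<epsilon> \<and>
        (\<forall>\<^sub>F n in sequentially. 1 - \<epsilon> \<le> measure (obs_space H n) (A n))"
  shows "cond_weak_conv_prob H Q T P G'"
proof -
  from Y obtain V \<Delta> where V: "majorant_versions H Q Y V"
    and \<Delta>: "outer_majorized H (\<lambda>n. cond_BL_dist Q (V n) P G) \<Delta>"
    and lim: "\<And>\<epsilon>. 0 < \<epsilon> \<Longrightarrow>
      (\<lambda>n. measure (obs_space H n) {x \<in> space (obs_space H n). \<bar>\<Delta> n x\<bar> > \<epsilon>}) \<longlonglongrightarrow> 0"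
    unfolding cond_weak_conv_prob_def tendsto_0_outer_prob_def by blast
  define e where "e i = 1 / real (Suc i)" for i
  have "\<forall>i. \<exists>A. (\<forall>n. A n \<in> sets (obs_space H n)) \<and> lipschitz_dominated Q P Y G T G' A (e i) \<and>
        (\<forall>\<^sub>F n in sequentially. 1 - e i \<le> measure (obs_space H n) (A n))"
    using dom by (auto simp: e_def)
  from choice[OF this] obtain A where "\<forall>i. (\<forall>n. A i n \<in> sets (obs_space H n)) \<and>
      lipschitz_dominated Q P Y G T G' (A i) (e i) \<and> (\<forall>\<^sub>F n in sequentially. 1 - e i \<le> measure (obs_space H n) (A i n))" ..
  then have A: "\<And>i n. A i n \<in> sets (obs_space H n)"
      "\<And>i. lipschitz_dominated Q P Y G T G' (A i) (e i)"
      "\<And>i. \<forall>\<^sub>F n in sequentially. 1 - e i \<le> measure (obs_space H n) (A i n)"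
    by simp_all
  from cond_weak_conv_transfer_dominated[where A=A and e=e, OF H Q P V \<Delta> A(1,2)] obtain V' \<Delta>' L where
      V': "majorant_versions H Q T V'" and \<Delta>': "outer_majorized H (\<lambda>n. cond_BL_dist Q (V' n) P G') \<Delta>'"
      and L: "\<forall>i. 1 \<le> L i"
      and "\<forall>n i x. i \<le> n \<longrightarrow> x \<in> A i n \<longrightarrow> 0 \<le> \<Delta>' n x \<and> \<Delta>' n x \<le> e i + L i * \<Delta> n x"
    by (elim exE conjE)
  then have le: "0 \<le> \<Delta>' n x \<and> \<Delta>' n x \<le> e i + L i * \<Delta> n x" if "i \<le> n" "x \<in> A i n" for n i x
    using that by simp
  have small: "(\<lambda>n. measure (obs_space H n) {x \<in> space (obs_space H n). \<bar>\<Delta>' n x\<bar> > \<epsilon>}) \<longlonglongrightarrow> 0" if "0 < \<epsilon>" for \<epsilon>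
  proof (rule order_tendstoI)
    fix \<eta> :: real assume "0 < \<eta>"
    then have "0 < min (\<epsilon> / 2) (\<eta> / 2)" using that by simp
    then obtain i where i: "e i < min (\<epsilon> / 2) (\<eta> / 2)"
      using reals_Archimedean[of "min (\<epsilon> / 2) (\<eta> / 2)"] by (auto simp: e_def inverse_eq_divide)
    have "0 < \<epsilon> / (2 * L i)" using that L[rule_format, of i] by simp
    from order_tendstoD(2)[OF lim[OF this], of "\<eta> / 2"] \<open>0 < \<eta>\<close>
    have "\<forall>\<^sub>F n in sequentially.
        measure (obs_space H n) {x \<in> space (obs_space H n). \<bar>\<Delta> n x\<bar> > \<epsilon> / (2 * L i)} < \<eta> / 2" by simp
    with A(3)[of i] eventually_ge_at_top[of i]
    show "\<forall>\<^sub>F n in sequentially.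
        measure (obs_space H n) {x \<in> space (obs_space H n). \<bar>\<Delta>' n x\<bar> > \<epsilon>} < \<eta>"
    proof eventually_elim
      case (elim n)
      interpret prob_space "obs_space H n" by (rule prob_space_obs_space[OF H])
      have [measurable]: "\<Delta> n \<in> borel_measurable (obs_space H n)" "\<Delta>' n \<in> borel_measurable (obs_space H n)"
          "A i n \<in> sets (obs_space H n)"
        using \<Delta> \<Delta>' A(1) by (auto simp: outer_majorized_def)
      let ?S = "space (obs_space H n)"
      have "{x \<in> ?S. \<bar>\<Delta>' n x\<bar> > \<epsilon>} \<subseteq> (?S - A i n) \<union> {x \<in> ?S. \<bar>\<Delta> n x\<bar> > \<epsilon> / (2 * L i)}"
      proof (rule subsetI, rule ccontr)
        fix x assume "x \<in> {x \<in> ?S. \<bar>\<Delta>' n x\<bar> > \<epsilon>}"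
          and "x \<notin> (?S - A i n) \<union> {x \<in> ?S. \<bar>\<Delta> n x\<bar> > \<epsilon> / (2 * L i)}"
        then have x: "\<bar>\<Delta>' n x\<bar> > \<epsilon>" "x \<in> A i n" "\<bar>\<Delta> n x\<bar> \<le> \<epsilon> / (2 * L i)"
          by (simp_all add: not_less)
        have "L i * \<Delta> n x \<le> L i * (\<epsilon> / (2 * L i))" using x(3) L[rule_format, of i] by (intro mult_left_mono) auto
        also have "\<dots> = \<epsilon> / 2" using L[rule_format, of i] by simp
        finally show False using le[OF elim(2) x(2)] i x(1) by auto
      qed
      then have "prob {x \<in> ?S. \<bar>\<Delta>' n x\<bar> > \<epsilon>} \<le> prob ((?S - A i n) \<union> {x \<in> ?S. \<bar>\<Delta> n x\<bar> > \<epsilon> / (2 * L i)})"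
        by (intro finite_measure_mono) auto
      also have "\<dots> \<le> prob (?S - A i n) + prob {x \<in> ?S. \<bar>\<Delta> n x\<bar> > \<epsilon> / (2 * L i)}"
        by (intro measure_Un_le) auto
      also have "prob (?S - A i n) = 1 - prob (A i n)" by (rule prob_compl) simp
      finally show ?case using elim i by auto
    qed
  next
    fix a :: real assume "a < 0"
    then show "\<forall>\<^sub>F n in sequentially.
        a < measure (obs_space H n) {x \<in> space (obs_space H n). \<bar>\<Delta>' n x\<bar> > \<epsilon>}"
      by (intro always_eventually allI) (rule less_le_trans[OF _ measure_nonneg])
  qed
  have "tendsto_0_outer_prob H (\<lambda>n. cond_BL_dist Q (V' n) P G')"
    unfolding tendsto_0_outer_prob_def by (intro exI[of _ \<Delta>'] conjI allI impI \<Delta>' small)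
  with V' show ?thesis
    unfolding cond_weak_conv_prob_def by (intro exI[of _ V'] conjI)
qed

text \<open>
  The bound \<open>e i + L i * \<Delta> n\<close> is applied along one sequence of observations, which lies eventually
  in the events of every level outside a null set.
\<close>

lemma cond_weak_conv_as_transfer:
  fixes Y :: "nat \<Rightarrow> (nat \<Rightarrow> 'x) \<times> 'z \<Rightarrow> 'm::metric_space" and T :: "nat \<Rightarrow> (nat \<Rightarrow> 'x) \<times> 'z \<Rightarrow> 'l::metric_space"
  assumes H: "prob_space H" and Q: "prob_space Q" and P: "prob_space P"
    and Y: "cond_weak_conv_as H Q Y P G"
    and dom: "\<And>\<epsilon>. 0 < \<epsilon> \<Longrightarrow> \<exists>A. (\<forall>n. A n \<in> sets (obs_space H n)) \<and> lipschitz_dominated Q P Y G T G' A \<epsilon> \<and>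
        (AE x in PiM UNIV (\<lambda>_::nat. H). \<forall>\<^sub>F n in sequentially. restrict x {..<n} \<in> A n)"
  shows "cond_weak_conv_as H Q T P G'"
proof -
  from Y obtain V \<Delta> where V: "majorant_versions H Q Y V"
    and \<Delta>: "outer_majorized H (\<lambda>n. cond_BL_dist Q (V n) P G) \<Delta>"
    and lim: "AE x in PiM UNIV (\<lambda>_::nat. H). (\<lambda>n. \<Delta> n (restrict x {..<n})) \<longlonglongrightarrow> 0"
    unfolding cond_weak_conv_as_def tendsto_0_outer_as_def by blast
  define e where "e i = 1 / real (Suc i)" for i
  have "\<forall>i. \<exists>A. (\<forall>n. A n \<in> sets (obs_space H n)) \<and> lipschitz_dominated Q P Y G T G' A (e i) \<and>
        (AE x in PiM UNIV (\<lambda>_::nat. H). \<forall>\<^sub>F n in sequentially. restrict x {..<n} \<in> A n)"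
    using dom by (auto simp: e_def)
  from choice[OF this] obtain A where "\<forall>i. (\<forall>n. A i n \<in> sets (obs_space H n)) \<and>
      lipschitz_dominated Q P Y G T G' (A i) (e i) \<and> (AE x in PiM UNIV (\<lambda>_::nat. H). \<forall>\<^sub>F n in sequentially. restrict x {..<n} \<in> A i n)" ..
  then have A: "\<And>i n. A i n \<in> sets (obs_space H n)"
      "\<And>i. lipschitz_dominated Q P Y G T G' (A i) (e i)"
      "\<And>i. AE x in PiM UNIV (\<lambda>_::nat. H). \<forall>\<^sub>F n in sequentially. restrict x {..<n} \<in> A i n"
    by simp_all
  from cond_weak_conv_transfer_dominated[where A=A and e=e, OF H Q P V \<Delta> A(1,2)] obtain V' \<Delta>' L where
      V': "majorant_versions H Q T V'" and \<Delta>': "outer_majorized H (\<lambda>n. cond_BL_dist Q (V' n) P G') \<Delta>'"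
      and L: "\<forall>i. 1 \<le> L i"
      and "\<forall>n i x. i \<le> n \<longrightarrow> x \<in> A i n \<longrightarrow> 0 \<le> \<Delta>' n x \<and> \<Delta>' n x \<le> e i + L i * \<Delta> n x"
    by (elim exE conjE)
  then have le: "0 \<le> \<Delta>' n x \<and> \<Delta>' n x \<le> e i + L i * \<Delta> n x" if "i \<le> n" "x \<in> A i n" for n i x
    using that by simp
  have "AE x in PiM UNIV (\<lambda>_::nat. H). \<forall>i. \<forall>\<^sub>F n in sequentially. restrict x {..<n} \<in> A i n"
    using A(3) by (simp add: AE_all_countable)
  with lim have "AE x in PiM UNIV (\<lambda>_::nat. H). (\<lambda>n. \<Delta>' n (restrict x {..<n})) \<longlonglongrightarrow> 0"
  proof eventually_elim
    case (elim x)
    show ?case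
    proof (rule tendstoI)
      fix \<epsilon> :: real assume "0 < \<epsilon>"
      then obtain i where i: "e i < \<epsilon> / 2"
        using reals_Archimedean[of "\<epsilon> / 2"] by (auto simp: e_def inverse_eq_divide)
      have "0 < \<epsilon> / (2 * L i)" using \<open>0 < \<epsilon>\<close> L[rule_format, of i] by simp
      from order_tendstoD(2)[OF elim(1) this] elim(2)[rule_format, of i] eventually_ge_at_top[of i]
      show "\<forall>\<^sub>F n in sequentially. dist (\<Delta>' n (restrict x {..<n})) 0 < \<epsilon>"
      proof eventually_elim
        case (elim n)
        have "L i * \<Delta> n (restrict x {..<n}) \<le> L i * (\<epsilon> / (2 * L i))"
          using elim(1) L[rule_format, of i] by (intro mult_left_mono) auto
        also have "\<dots> = \<epsilon> / 2" using L[rule_format, of i] by simp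
        finally show ?case using le[OF elim(3,2)] i by (simp add: dist_real_def)
      qed
    qed
  qed
  with V' \<Delta>' show ?thesis
    unfolding cond_weak_conv_as_def tendsto_0_outer_as_def
    by (intro exI[of _ V'] exI[of _ \<Delta>'] conjI allI impI)
qed

section \<open>Hadamard differentiability along sample sizes\<close>

lemma tendsto_inverse_sqrt_nat:
  assumes "\<And>k. max 1 k \<le> m k"
  shows "(\<lambda>k. 1 / sqrt (real (m k))) \<longlonglongrightarrow> 0"
proof -
  have "filterlim m at_top sequentially"
    using assms by (intro filterlim_at_top_mono[OF filterlim_ident]) (auto simp: always_eventually)
  then have "filterlim (\<lambda>k. sqrt (real (m k))) at_top sequentially"
    by (intro filterlim_compose[OF sqrt_at_top] filterlim_compose[OF filterlim_real_sequentially])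
  then show ?thesis by (intro tendsto_divide_0[OF tendsto_const] filterlim_at_top_imp_at_infinity)
qed

lemma hadamard_sqrt_limit:
  assumes "has_hadamard_derivative \<phi> D\<^sub>\<phi> D0 \<theta> L"
    and "\<And>k. max 1 k \<le> m k" and "hs \<longlonglongrightarrow> h" and "h \<in> D0"
    and "\<And>k. \<theta> + (1 / sqrt (real (m k))) *\<^sub>R hs k \<in> D\<^sub>\<phi>"
  shows "(\<lambda>k. sqrt (real (m k)) *\<^sub>R (\<phi> (\<theta> + (1 / sqrt (real (m k))) *\<^sub>R hs k) - \<phi> \<theta>)) \<longlonglongrightarrow> L h"
proof -
  have "1 / sqrt (real (m k)) \<noteq> 0" for k using assms(2)[of k] by auto
  then show ?thesis
    using assms tendsto_inverse_sqrt_nat[OF assms(2)]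
    unfolding has_hadamard_derivative_def
    by (elim conjE allE[of _ "\<lambda>k. 1 / sqrt (real (m k))"] allE[of _ hs] allE[of _ h]) simp
qed

lemma uniform_hadamard_sqrt_limit:
  assumes "has_uniform_hadamard_derivative \<phi> D\<^sub>\<phi> D0 \<theta> L"
    and "\<And>k. max 1 k \<le> m k" and "hs \<longlonglongrightarrow> h" and "h \<in> D0" and "\<theta>s \<longlonglongrightarrow> \<theta>"
    and "\<And>k. \<theta>s k \<in> D\<^sub>\<phi>" and "\<And>k. \<theta>s k + (1 / sqrt (real (m k))) *\<^sub>R hs k \<in> D\<^sub>\<phi>"
  shows "(\<lambda>k. sqrt (real (m k)) *\<^sub>R (\<phi> (\<theta>s k + (1 / sqrt (real (m k))) *\<^sub>R hs k) - \<phi> (\<theta>s k))) \<longlonglongrightarrow> L h"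
proof -
  have "1 / sqrt (real (m k)) \<noteq> 0" for k using assms(2)[of k] by auto
  then show ?thesis
    using assms tendsto_inverse_sqrt_nat[OF assms(2)]
    unfolding has_uniform_hadamard_derivative_def
    by (elim conjE allE[of _ "\<lambda>k. 1 / sqrt (real (m k))"] allE[of _ \<theta>s] allE[of _ hs] allE[of _ h]) simp
qed

text \<open>
  The increment of \<open>\<phi>\<close> between \<open>\<theta>s k\<close> and \<open>\<theta>s k + hs k / \<surd>m\<close> is the difference of two increments
  that start at \<open>\<theta>\<close>, in the directions \<open>s k + hs k\<close> and \<open>s k\<close> with \<open>s k = \<surd>m (\<theta>s k - \<theta>)\<close>. By compactness
  \<open>s k\<close> converges along a subsequence to a point \<open>l\<close> of \<open>K\<close>. Differentiability applies to both increments
  because \<open>l\<close> and \<open>l + h\<close> lie in \<open>D0\<close>, and linearity removes \<open>l\<close> from the difference of the limits.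
\<close>

lemma hadamard_sqrt_limit_compact:
  fixes \<phi> :: "'d::real_normed_vector \<Rightarrow> 'e::real_normed_vector"
  assumes \<phi>: "has_hadamard_derivative \<phi> D\<^sub>\<phi> D0 \<theta> L" and D0: "subspace D0" and K: "compact K" "K \<subseteq> D0"
    and m: "\<And>k. max 1 k \<le> m k" and hs: "hs \<longlonglongrightarrow> h" and h: "h \<in> D0"
    and \<theta>s: "\<And>k. sqrt (real (m k)) *\<^sub>R (\<theta>s k - \<theta>) \<in> (\<Union>\<kappa>\<in>K. ball \<kappa> (1 / real (Suc k)))"
    and dom: "\<And>k. \<theta>s k \<in> D\<^sub>\<phi>" "\<And>k. \<theta>s k + (1 / sqrt (real (m k))) *\<^sub>R hs k \<in> D\<^sub>\<phi>"
  shows "\<exists>r::nat \<Rightarrow> nat. strict_mono r \<and>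
    (\<lambda>k. sqrt (real (m (r k))) *\<^sub>R (\<phi> (\<theta>s (r k) + (1 / sqrt (real (m (r k)))) *\<^sub>R hs (r k)) - \<phi> (\<theta>s (r k)))) \<longlonglongrightarrow> L h"
proof -
  define s where "s k = sqrt (real (m k)) *\<^sub>R (\<theta>s k - \<theta>)" for k
  have s: "\<theta> + (1 / sqrt (real (m k))) *\<^sub>R s k = \<theta>s k" for k
    using m[of k] by (simp add: s_def)
  have "\<forall>k. \<exists>\<kappa>\<in>K. dist \<kappa> (s k) < 1 / real (Suc k)" using \<theta>s unfolding s_def by auto
  then obtain \<kappa> where \<kappa>: "\<And>k. \<kappa> k \<in> K" "\<And>k. dist (\<kappa> k) (s k) < 1 / real (Suc k)" by metis
  from K(1) \<kappa>(1) obtain l r where l: "l \<in> K" "strict_mono (r :: nat \<Rightarrow> nat)" "(\<kappa> \<circ> r) \<longlonglongrightarrow> l"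
    unfolding compact_def by metis
  have "(\<lambda>k. dist (\<kappa> k) (s k)) \<longlonglongrightarrow> 0"
  proof (rule real_tendsto_sandwich[where f="\<lambda>_. 0" and h="\<lambda>k. 1 / real (Suc k)"])
    show "(\<lambda>k. 1 / real (Suc k)) \<longlonglongrightarrow> 0" by (rule LIMSEQ_Suc[OF lim_1_over_n])
  qed (use \<kappa>(2) in \<open>auto intro!: always_eventually less_imp_le\<close>)
  then have "(\<lambda>k. dist (\<kappa> (r k)) (s (r k))) \<longlonglongrightarrow> 0"
    using LIMSEQ_subseq_LIMSEQ[OF _ l(2)] by (auto simp: o_def)
  then have "(\<lambda>k. s (r k) - \<kappa> (r k)) \<longlonglongrightarrow> 0"
    by (simp add: dist_commute[of "\<kappa> _"]) (simp add: dist_norm tendsto_norm_zero_iff)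
  from tendsto_add[OF this l(3)[unfolded o_def]] have sr: "(\<lambda>k. s (r k)) \<longlonglongrightarrow> l" by simp
  have hr: "(\<lambda>k. hs (r k)) \<longlonglongrightarrow> h" using LIMSEQ_subseq_LIMSEQ[OF hs l(2)] by (simp add: o_def)
  have mr: "max 1 k \<le> m (r k)" for k using m[of "r k"] strict_mono_imp_increasing[OF l(2), of k] by auto
  have lD: "l \<in> D0" using l(1) K(2) by auto
  have 1: "(\<lambda>k. sqrt (real (m (r k))) *\<^sub>R (\<phi> (\<theta> + (1 / sqrt (real (m (r k)))) *\<^sub>R (s (r k) + hs (r k))) - \<phi> \<theta>))
      \<longlonglongrightarrow> L (l + h)"
    using tendsto_add[OF sr hr] subspace_add[OF D0 lD h] dom(2)
    by (intro hadamard_sqrt_limit[OF \<phi> mr]) (simp_all add: scaleR_add_right add.assoc[symmetric] s)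
  have 2: "(\<lambda>k. sqrt (real (m (r k))) *\<^sub>R (\<phi> (\<theta> + (1 / sqrt (real (m (r k)))) *\<^sub>R s (r k)) - \<phi> \<theta>)) \<longlonglongrightarrow> L l"
    using sr lD dom(1) by (intro hadamard_sqrt_limit[OF \<phi> mr]) (simp_all add: s)
  have "l \<in> span D0" "h \<in> span D0" using lD h by (auto intro: span_base)
  then have "L (l + h) - L l = L h"
    using \<phi> by (simp add: has_hadamard_derivative_def continuous_linear_on_span_def)
  with tendsto_diff[OF 1 2] l(2) show ?thesis
    by (intro exI[of _ r]) (simp add: scaleR_diff_right[symmetric] scaleR_add_right add.assoc[symmetric] s)
qed

text \<open>
  The pairs of a rescaled deviation and the resulting statistic, for sample sizes \<open>m \<ge> k\<close> and
  centers in \<open>\<Theta> k m\<close>. It is a relation and not a function of \<open>y\<close>, since sample size and center vary;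
  \<open>m \<ge> 1\<close> excludes division by \<open>\<surd>0\<close>.
\<close>

definition increment_graph ::
  "('d::real_normed_vector \<Rightarrow> 'e::real_normed_vector) \<Rightarrow> 'd set \<Rightarrow> (nat \<Rightarrow> nat \<Rightarrow> 'd set) \<Rightarrow> nat \<Rightarrow> ('d \<times> real) set" where
  "increment_graph \<phi> D\<^sub>\<phi> \<Theta> k = {(y, c). \<exists>m \<theta>. max 1 k \<le> m \<and> \<theta> \<in> \<Theta> k m \<and> \<theta> \<in> D\<^sub>\<phi> \<and>
     \<theta> + (1 / sqrt (real m)) *\<^sub>R y \<in> D\<^sub>\<phi> \<and>
     c = sqrt (real m) * norm (\<phi> (\<theta> + (1 / sqrt (real m)) *\<^sub>R y) - \<phi> \<theta>)}"

lemma increment_graph_antimono: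
  assumes "k \<le> l" and "\<And>m. \<Theta> l m \<subseteq> \<Theta> k m"
  shows "increment_graph \<phi> D\<^sub>\<phi> \<Theta> l \<subseteq> increment_graph \<phi> D\<^sub>\<phi> \<Theta> k"
proof clarify
  fix y c assume "(y, c) \<in> increment_graph \<phi> D\<^sub>\<phi> \<Theta> l"
  then obtain m \<theta> where "max 1 l \<le> m" "\<theta> \<in> \<Theta> l m" "\<theta> \<in> D\<^sub>\<phi>" "\<theta> + (1 / sqrt (real m)) *\<^sub>R y \<in> D\<^sub>\<phi>"
      "c = sqrt (real m) * norm (\<phi> (\<theta> + (1 / sqrt (real m)) *\<^sub>R y) - \<phi> \<theta>)"
    unfolding increment_graph_def by blast
  with assms show "(y, c) \<in> increment_graph \<phi> D\<^sub>\<phi> \<Theta> k"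
    unfolding increment_graph_def by (auto intro!: exI[of _ m] exI[of _ \<theta>])
qed

text \<open>
  Reduces the continuous mapping condition for the graph to a limit along sequences of sample sizes and
  centers, which is the form in which differentiability is stated.
\<close>

lemma increment_graph_limit:
  assumes lim: "\<And>m \<theta>s. (\<And>k. max 1 k \<le> m k) \<Longrightarrow> (\<And>k. \<theta>s k \<in> \<Theta> k (m k)) \<Longrightarrow> (\<And>k. \<theta>s k \<in> D\<^sub>\<phi>) \<Longrightarrow>
      (\<And>k. \<theta>s k + (1 / sqrt (real (m k))) *\<^sub>R fst (p k) \<in> D\<^sub>\<phi>) \<Longrightarrow>
      \<exists>r::nat \<Rightarrow> nat. strict_mono r \<and> (\<lambda>k. sqrt (real (m (r k))) *\<^sub>R
        (\<phi> (\<theta>s (r k) + (1 / sqrt (real (m (r k)))) *\<^sub>R fst (p (r k))) - \<phi> (\<theta>s (r k)))) \<longlonglongrightarrow> l"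
    and p: "\<And>k. p k \<in> increment_graph \<phi> D\<^sub>\<phi> \<Theta> k"
  shows "\<exists>r::nat \<Rightarrow> nat. strict_mono r \<and> (\<lambda>k. snd (p (r k))) \<longlonglongrightarrow> norm l"
proof -
  have "\<forall>k. \<exists>m \<theta>. max 1 k \<le> m \<and> \<theta> \<in> \<Theta> k m \<and> \<theta> \<in> D\<^sub>\<phi> \<and> \<theta> + (1 / sqrt (real m)) *\<^sub>R fst (p k) \<in> D\<^sub>\<phi> \<and>
     snd (p k) = sqrt (real m) * norm (\<phi> (\<theta> + (1 / sqrt (real m)) *\<^sub>R fst (p k)) - \<phi> \<theta>)"
    using p unfolding increment_graph_def by (auto simp: case_prod_beta)
  then have "\<exists>m. \<forall>k. \<exists>\<theta>. max 1 k \<le> m k \<and> \<theta> \<in> \<Theta> k (m k) \<and> \<theta> \<in> D\<^sub>\<phi> \<and>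
     \<theta> + (1 / sqrt (real (m k))) *\<^sub>R fst (p k) \<in> D\<^sub>\<phi> \<and>
     snd (p k) = sqrt (real (m k)) * norm (\<phi> (\<theta> + (1 / sqrt (real (m k))) *\<^sub>R fst (p k)) - \<phi> \<theta>)"
    by (rule choice)
  then obtain m where "\<forall>k. \<exists>\<theta>. max 1 k \<le> m k \<and> \<theta> \<in> \<Theta> k (m k) \<and> \<theta> \<in> D\<^sub>\<phi> \<and>
     \<theta> + (1 / sqrt (real (m k))) *\<^sub>R fst (p k) \<in> D\<^sub>\<phi> \<and>
     snd (p k) = sqrt (real (m k)) * norm (\<phi> (\<theta> + (1 / sqrt (real (m k))) *\<^sub>R fst (p k)) - \<phi> \<theta>)" ..
  from choice[OF this] obtain \<theta>s where m: "\<And>k. max 1 k \<le> m k" "\<And>k. \<theta>s k \<in> \<Theta> k (m k)" "\<And>k. \<theta>s k \<in> D\<^sub>\<phi>"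
      "\<And>k. \<theta>s k + (1 / sqrt (real (m k))) *\<^sub>R fst (p k) \<in> D\<^sub>\<phi>"
      and c: "\<And>k. snd (p k) = sqrt (real (m k)) * norm (\<phi> (\<theta>s k + (1 / sqrt (real (m k))) *\<^sub>R fst (p k)) - \<phi> (\<theta>s k))"
    by blast
  from lim[OF m] obtain r :: "nat \<Rightarrow> nat" where r: "strict_mono r" "(\<lambda>k. sqrt (real (m (r k))) *\<^sub>R
        (\<phi> (\<theta>s (r k) + (1 / sqrt (real (m (r k)))) *\<^sub>R fst (p (r k))) - \<phi> (\<theta>s (r k)))) \<longlonglongrightarrow> l" by auto
  from tendsto_norm[OF r(2)] r(1) show ?thesis by (intro exI[of _ r]) (simp add: c)
qed

lemma continuous_on_norm_derivative:
  assumes "continuous_linear_on_span D0 L" and "subspace D0"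
  shows "continuous_on D0 (\<lambda>y. norm (L y))"
  using assms by (intro continuous_on_norm) (simp add: continuous_linear_on_span_def span_eq_iff[THEN iffD2])

section \<open>The delta method\<close>

text \<open>
  The image of the graph of increments under the test function has limit \<open>g (norm (L y))\<close>, so that the
  one-sided mapping theorem applies to both \<open>h\<close> and \<open>- h\<close>.
\<close>

lemma weak_conv_delta_method:
  fixes \<phi> :: "'d::real_normed_vector \<Rightarrow> 'e::real_normed_vector"
  assumes M: "\<And>n. prob_space (M n)" and P: "prob_space P"
    and D0: "subspace D0"
    and \<phi>: "has_hadamard_derivative \<phi> D\<^sub>\<phi> D0 \<theta> L"
    and G: "G \<in> measurable P borel" "\<And>\<omega>. \<omega> \<in> space P \<Longrightarrow> G \<omega> \<in> D0"
    and S: "\<And>n \<omega>. n \<ge> 1 \<Longrightarrow> \<omega> \<in> space (M n) \<Longrightarrow> S n \<omega> \<in> D\<^sub>\<phi>"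
    and Y: "weak_conv_HJ M (\<lambda>n \<omega>. sqrt (real n) *\<^sub>R (S n \<omega> - \<theta>)) P G"
  shows "weak_conv_HJ M (\<lambda>n \<omega>. sqrt (real n) * norm (\<phi> (S n \<omega>) - \<phi> \<theta>)) P (\<lambda>\<omega>. norm (L (G \<omega>)))"
  unfolding weak_conv_HJ_def
proof (intro allI impI)
  fix h :: "real \<Rightarrow> real"
  assume h: "continuous_on UNIV h \<and> bounded (range h)"
  let ?T = "\<lambda>n \<omega>. sqrt (real n) * norm (\<phi> (S n \<omega>) - \<phi> \<theta>)"
  let ?\<Theta> = "\<lambda>_ _. {\<theta>}"
  obtain B where B: "0 < B" "\<And>c. \<bar>h c\<bar> \<le> B"
    using h by (auto simp: bounded_pos)
  have upper: "\<forall>\<^sub>F n in sequentially. outer_expectation (M n) (\<lambda>\<omega>. g (?T n \<omega>)) < (\<integral>\<omega>. g (norm (L (G \<omega>))) \<partial>P) + \<epsilon>"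
    if g: "continuous_on UNIV g" "\<And>c. \<bar>g c\<bar> \<le> B" and "0 < \<epsilon>" for g :: "real \<Rightarrow> real" and \<epsilon>
  proof (rule weak_conv_HJ_majorant[where F="\<lambda>k. (\<lambda>(y, c). (y, g c)) ` increment_graph \<phi> D\<^sub>\<phi> ?\<Theta> k", OF M P G Y])
    show "continuous_on D0 (\<lambda>y. g (norm (L y)))"
      using \<phi> by (intro continuous_on_compose2[OF g(1) continuous_on_norm_derivative[OF _ D0]])
        (auto simp: has_hadamard_derivative_def)
    show "(\<lambda>(y, c). (y, g c)) ` increment_graph \<phi> D\<^sub>\<phi> ?\<Theta> l \<subseteq> (\<lambda>(y, c). (y, g c)) ` increment_graph \<phi> D\<^sub>\<phi> ?\<Theta> k"
      if "k \<le> l" for k l by (intro image_mono increment_graph_antimono that subset_refl)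
    show "g (norm (L y)) \<in> {- B..B}" for y using g(2)[of "norm (L y)"] by (auto simp: abs_le_iff)
    show "g (?T n \<omega>) \<in> {- B..B}" for n \<omega> using g(2)[of "?T n \<omega>"] by (auto simp: abs_le_iff)
  next
    fix y p
    assume y: "y \<in> D0" and p: "\<And>k. p k \<in> (\<lambda>(y, c). (y, g c)) ` increment_graph \<phi> D\<^sub>\<phi> ?\<Theta> k"
      and lim: "(\<lambda>k. fst (p k)) \<longlonglongrightarrow> y"
    have "\<forall>k. \<exists>q. q \<in> increment_graph \<phi> D\<^sub>\<phi> ?\<Theta> k \<and> p k = (fst q, g (snd q))"
      using p unfolding image_iff case_prod_beta Bex_def by (rule allI)
    from choice[OF this] obtain q where
      q: "\<And>k. q k \<in> increment_graph \<phi> D\<^sub>\<phi> ?\<Theta> k" "\<And>k. p k = (fst (q k), g (snd (q k)))" by blast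
    have "\<exists>r::nat \<Rightarrow> nat. strict_mono r \<and> (\<lambda>k. snd (q (r k))) \<longlonglongrightarrow> norm (L y)"
    proof (rule increment_graph_limit[OF _ q(1)])
      fix m :: "nat \<Rightarrow> nat" and \<theta>s
      assume m: "\<And>k. max 1 k \<le> m k" and \<theta>s: "\<And>k. \<theta>s k \<in> {\<theta>}"
        and dom: "\<And>k. \<theta>s k + (1 / sqrt (real (m k))) *\<^sub>R fst (q k) \<in> D\<^sub>\<phi>"
      have "(\<lambda>k. sqrt (real (m k)) *\<^sub>R (\<phi> (\<theta> + (1 / sqrt (real (m k))) *\<^sub>R fst (q k)) - \<phi> \<theta>)) \<longlonglongrightarrow> L y"
        using lim q(2) y dom \<theta>s by (intro hadamard_sqrt_limit[OF \<phi> m]) auto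
      then show "\<exists>r::nat \<Rightarrow> nat. strict_mono r \<and> (\<lambda>k. sqrt (real (m (r k))) *\<^sub>R
        (\<phi> (\<theta>s (r k) + (1 / sqrt (real (m (r k)))) *\<^sub>R fst (q (r k))) - \<phi> (\<theta>s (r k)))) \<longlonglongrightarrow> L y"
        using \<theta>s by (intro exI[of _ id]) (simp add: strict_mono_id)
    qed
    then obtain r :: "nat \<Rightarrow> nat" where r: "strict_mono r" "(\<lambda>k. snd (q (r k))) \<longlonglongrightarrow> norm (L y)" by auto
    have "isCont g (norm (L y))" using g(1) by (simp add: continuous_on_eq_continuous_at)
    from isCont_tendsto_compose[OF this r(2)] r(1)
    show "\<exists>r::nat \<Rightarrow> nat. strict_mono r \<and> (\<lambda>k. snd (p (r k))) \<longlonglongrightarrow> g (norm (L y))"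
      by (intro exI[of _ r]) (simp add: q(2))
  next
    fix k n \<omega> assume "1 \<le> k" "k \<le> n" and \<omega>: "\<omega> \<in> space (M n)"
    then have n: "1 \<le> n" by simp
    have "\<theta> + (1 / sqrt (real n)) *\<^sub>R (sqrt (real n) *\<^sub>R (S n \<omega> - \<theta>)) = S n \<omega>" using n by simp
    then have "(sqrt (real n) *\<^sub>R (S n \<omega> - \<theta>), ?T n \<omega>) \<in> increment_graph \<phi> D\<^sub>\<phi> ?\<Theta> k"
      using S[OF n \<omega>] \<phi> n \<open>k \<le> n\<close> unfolding increment_graph_def
      by (auto simp: has_hadamard_derivative_def intro!: exI[of _ n])
    then show "(sqrt (real n) *\<^sub>R (S n \<omega> - \<theta>), g (?T n \<omega>)) \<in> (\<lambda>(y, c). (y, g c)) ` increment_graph \<phi> D\<^sub>\<phi> ?\<Theta> k"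
      by (rule rev_image_eqI) simp
  qed (use B(1) \<open>0 < \<epsilon>\<close> in auto)
  show "(\<lambda>n. outer_expectation (M n) (\<lambda>\<omega>. h (?T n \<omega>))) \<longlonglongrightarrow> (\<integral>\<omega>. h (norm (L (G \<omega>))) \<partial>P)"
  proof (rule order_tendstoI)
    fix a assume "(\<integral>\<omega>. h (norm (L (G \<omega>))) \<partial>P) < a"
    then show "\<forall>\<^sub>F n in sequentially. outer_expectation (M n) (\<lambda>\<omega>. h (?T n \<omega>)) < a"
      using upper[of h "a - (\<integral>\<omega>. h (norm (L (G \<omega>))) \<partial>P)"] h B by simp
  next
    fix a assume a: "a < (\<integral>\<omega>. h (norm (L (G \<omega>))) \<partial>P)"
    have "\<forall>\<^sub>F n in sequentially. outer_expectation (M n) (\<lambda>\<omega>. - h (?T n \<omega>)) < - a"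
      using upper[of "\<lambda>c. - h c" "(\<integral>\<omega>. h (norm (L (G \<omega>))) \<partial>P) - a"] h B a by (simp add: continuous_on_minus)
    then show "\<forall>\<^sub>F n in sequentially. a < outer_expectation (M n) (\<lambda>\<omega>. h (?T n \<omega>))"
    proof eventually_elim
      case (elim n)
      interpret prob_space "M n" by (rule M)
      have "- outer_expectation (M n) (\<lambda>\<omega>. - h (?T n \<omega>)) \<le> outer_expectation (M n) (\<lambda>\<omega>. h (?T n \<omega>))"
        using B(2) by (intro outer_expectation_minus[of _ B]) (auto simp: abs_le_iff minus_le_iff)
      with elim show ?case by simp
    qed
  qed
qed

text \<open>
  The indicator of \<open>T \<le> t\<close> converges continuously to 0: along a convergent sequence of deviations,
  differentiability makes \<open>\<phi>\<close> tend to \<open>\<phi> \<theta> \<noteq> 0\<close>, so that \<open>\<surd>n\<close> times its norm exceeds \<open>t\<close> eventually.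
\<close>

lemma weak_conv_infinity_delta_method:
  fixes \<phi> :: "'d::real_normed_vector \<Rightarrow> 'e::real_normed_vector"
  assumes M: "\<And>n. prob_space (M n)" and P: "prob_space P"
    and \<phi>: "has_hadamard_derivative \<phi> D\<^sub>\<phi> D0 \<theta> L" "\<phi> \<theta> \<noteq> 0"
    and G: "G \<in> measurable P borel" "\<And>\<omega>. \<omega> \<in> space P \<Longrightarrow> G \<omega> \<in> D0"
    and S: "\<And>n \<omega>. n \<ge> 1 \<Longrightarrow> \<omega> \<in> space (M n) \<Longrightarrow> S n \<omega> \<in> D\<^sub>\<phi>"
    and Y: "weak_conv_HJ M (\<lambda>n \<omega>. sqrt (real n) *\<^sub>R (S n \<omega> - \<theta>)) P G"
  shows "weak_conv_infinity M (\<lambda>n \<omega>. sqrt (real n) * norm (\<phi> (S n \<omega>)))"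
  unfolding weak_conv_infinity_def
proof
  fix t :: real
  let ?T = "\<lambda>n \<omega>. sqrt (real n) * norm (\<phi> (S n \<omega>))"
  define c where "c m y = (of_bool (sqrt (real m) * norm (\<phi> (\<theta> + (1 / sqrt (real m)) *\<^sub>R y)) \<le> t) :: real)"
    for m :: nat and y
  define F where "F k = {(y, c m y) | m y. max 1 k \<le> m \<and> \<theta> + (1 / sqrt (real m)) *\<^sub>R y \<in> D\<^sub>\<phi>}" for k
  have upper: "\<forall>\<^sub>F n in sequentially.
      outer_expectation (M n) (\<lambda>\<omega>. of_bool (\<omega> \<notin> {\<omega>. t < ?T n \<omega>})) < (\<integral>\<omega>. 0 \<partial>P) + \<epsilon>" if "0 < \<epsilon>" for \<epsilon> :: real
  proof (rule weak_conv_HJ_majorant[where F=F and B=1 and f="\<lambda>_. 0", OF M P G Y])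
    show "F l \<subseteq> F k" if "k \<le> l" for k l using that unfolding F_def by fastforce
    show "0 < \<epsilon>" by fact
  next
    fix y and p :: "nat \<Rightarrow> 'd \<times> real"
    assume y: "y \<in> D0" and p: "\<And>k. p k \<in> F k" and lim: "(\<lambda>k. fst (p k)) \<longlonglongrightarrow> y"
    have "\<forall>k. \<exists>m. max 1 k \<le> m \<and> \<theta> + (1 / sqrt (real m)) *\<^sub>R fst (p k) \<in> D\<^sub>\<phi> \<and> snd (p k) = c m (fst (p k))"
    proof
      fix k show "\<exists>m. max 1 k \<le> m \<and> \<theta> + (1 / sqrt (real m)) *\<^sub>R fst (p k) \<in> D\<^sub>\<phi> \<and> snd (p k) = c m (fst (p k))"
        using p[of k] unfolding F_def by auto
    qed
    from choice[OF this] obtain m where m: "\<And>k. max 1 k \<le> m k"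
        "\<And>k. \<theta> + (1 / sqrt (real (m k))) *\<^sub>R fst (p k) \<in> D\<^sub>\<phi>" "\<And>k. snd (p k) = c (m k) (fst (p k))" by blast
    let ?v = "\<lambda>k. \<phi> (\<theta> + (1 / sqrt (real (m k))) *\<^sub>R fst (p k))"
    have t0: "(\<lambda>k. 1 / sqrt (real (m k))) \<longlonglongrightarrow> 0" by (rule tendsto_inverse_sqrt_nat[OF m(1)])
    have "(\<lambda>k. (1 / sqrt (real (m k))) *\<^sub>R (sqrt (real (m k)) *\<^sub>R (?v k - \<phi> \<theta>))) \<longlonglongrightarrow> 0 *\<^sub>R L y"
      by (rule tendsto_scaleR[OF t0 hadamard_sqrt_limit[OF \<phi>(1) m(1) lim y m(2)]])
    moreover have "(1 / sqrt (real (m k))) *\<^sub>R (sqrt (real (m k)) *\<^sub>R (?v k - \<phi> \<theta>)) = ?v k - \<phi> \<theta>" for k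
      using m(1)[of k] by simp
    ultimately have "(\<lambda>k. ?v k - \<phi> \<theta>) \<longlonglongrightarrow> 0" by simp
    then have v: "(\<lambda>k. norm (?v k)) \<longlonglongrightarrow> norm (\<phi> \<theta>)" by (intro tendsto_norm) (rule Lim_transform, simp_all add: LIM_zero_cancel)
    have "(\<lambda>k. (1 / sqrt (real (m k))) * t) \<longlonglongrightarrow> 0 * t" by (intro tendsto_mult t0 tendsto_const)
    from tendsto_diff[OF v this] have "(\<lambda>k. norm (?v k) - (1 / sqrt (real (m k))) * t) \<longlonglongrightarrow> norm (\<phi> \<theta>)" by simp
    from order_tendstoD(1)[OF this, of 0] \<phi>(2)
    have "\<forall>\<^sub>F k in sequentially. 0 < norm (?v k) - (1 / sqrt (real (m k))) * t" by simp
    then have "\<forall>\<^sub>F k in sequentially. snd (p k) = 0"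
    proof eventually_elim
      case (elim k)
      have "0 < sqrt (real (m k))" using m(1)[of k] by simp
      with elim have "t < sqrt (real (m k)) * norm (?v k)" by (simp add: field_simps)
      then show ?case by (simp add: m(3) c_def)
    qed
    then have "(\<lambda>k. snd (p k)) \<longlonglongrightarrow> 0" by (rule tendsto_eventually)
    then show "\<exists>r::nat \<Rightarrow> nat. strict_mono r \<and> (\<lambda>k. snd (p (r k))) \<longlonglongrightarrow> 0"
      by (intro exI[of _ id]) (simp add: strict_mono_id)
  next
    fix k n \<omega> assume "1 \<le> k" "k \<le> n" and \<omega>: "\<omega> \<in> space (M n)"
    then have n: "1 \<le> n" by simp
    have "\<theta> + (1 / sqrt (real n)) *\<^sub>R (sqrt (real n) *\<^sub>R (S n \<omega> - \<theta>)) = S n \<omega>" using n by simp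
    then show "(sqrt (real n) *\<^sub>R (S n \<omega> - \<theta>), of_bool (\<omega> \<notin> {\<omega>. t < ?T n \<omega>})) \<in> F k"
      using S[OF n \<omega>] n \<open>k \<le> n\<close> unfolding F_def c_def
      by (intro CollectI exI[of _ n] exI[of _ "sqrt (real n) *\<^sub>R (S n \<omega> - \<theta>)"]) (simp add: not_less)
  qed auto
  show "(\<lambda>n. inner_prob (M n) {\<omega> \<in> space (M n). t < ?T n \<omega>}) \<longlonglongrightarrow> 1"
  proof (rule order_tendstoI)
    fix a :: real assume "a < 1"
    then have "0 < 1 - a" by simp
    from upper[OF this]
    show "\<forall>\<^sub>F n in sequentially. a < inner_prob (M n) {\<omega> \<in> space (M n). t < ?T n \<omega>}"
    proof eventually_elim
      case (elim n)
      interpret prob_space "M n" by (rule M)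
      show ?case using inner_prob_outer_expectation[of "{\<omega>. t < ?T n \<omega>}" "1 - a"] elim by simp
    qed
  next
    fix a :: real assume "1 < a"
    then show "\<forall>\<^sub>F n in sequentially. inner_prob (M n) {\<omega> \<in> space (M n). t < ?T n \<omega>} < a"
      using prob_space.inner_prob_le_1[OF M] by (intro always_eventually allI) (rule le_less_trans)
  qed
qed

text \<open>
  The level \<open>k\<close> depends only on the accuracy \<open>\<epsilon>\<close>, and it is fixed before the events \<open>A n\<close>, because these
  are then chosen to confine the centers to \<open>\<Theta> k n\<close>.
\<close>

lemma lipschitz_dominated_delta_method:
  fixes \<phi> :: "'d::real_normed_vector \<Rightarrow> 'e::real_normed_vector" and \<Theta> :: "nat \<Rightarrow> nat \<Rightarrow> 'd set"
    and S :: "nat \<Rightarrow> (nat \<Rightarrow> 'x) \<times> 'z \<Rightarrow> 'd" and C :: "nat \<Rightarrow> (nat \<Rightarrow> 'x) \<Rightarrow> 'd"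
  assumes P: "prob_space P" and D0: "subspace D0" and L: "continuous_linear_on_span D0 L"
    and G: "G \<in> measurable P borel" "\<And>\<omega>. \<omega> \<in> space P \<Longrightarrow> G \<omega> \<in> D0"
    and \<Theta>: "\<And>k l m. k \<le> l \<Longrightarrow> \<Theta> l m \<subseteq> \<Theta> k m"
    and lim: "\<And>m \<theta>s ys y. (\<And>k. max 1 k \<le> m k) \<Longrightarrow> (\<And>k. \<theta>s k \<in> \<Theta> k (m k)) \<Longrightarrow> (\<And>k. \<theta>s k \<in> D\<^sub>\<phi>) \<Longrightarrow>
      (\<And>k. \<theta>s k + (1 / sqrt (real (m k))) *\<^sub>R ys k \<in> D\<^sub>\<phi>) \<Longrightarrow> ys \<longlonglongrightarrow> y \<Longrightarrow> y \<in> D0 \<Longrightarrow>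
      \<exists>r::nat \<Rightarrow> nat. strict_mono r \<and> (\<lambda>k. sqrt (real (m (r k))) *\<^sub>R
        (\<phi> (\<theta>s (r k) + (1 / sqrt (real (m (r k)))) *\<^sub>R ys (r k)) - \<phi> (\<theta>s (r k)))) \<longlonglongrightarrow> L y"
    and "0 < \<epsilon>"
  shows "\<exists>k\<ge>1. \<forall>A. (\<forall>n. \<forall>x\<in>A n. k \<le> n \<and> C n x \<in> \<Theta> k n \<inter> D\<^sub>\<phi> \<and> (\<forall>z\<in>space Q. S n (x, z) \<in> D\<^sub>\<phi>)) \<longrightarrow>
    lipschitz_dominated Q P (\<lambda>n \<omega>. sqrt (real n) *\<^sub>R (S n \<omega> - C n (fst \<omega>))) G
      (\<lambda>n \<omega>. sqrt (real n) * norm (\<phi> (S n \<omega>) - \<phi> (C n (fst \<omega>)))) (\<lambda>\<omega>. norm (L (G \<omega>))) A \<epsilon>"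
proof -
  have "\<exists>k\<ge>1. \<forall>h\<in>BL1. \<exists>u. (real k)-lipschitz_on UNIV u \<and> range u \<subseteq> {-1..1} \<and>
      (\<integral>\<omega>. u (G \<omega>) \<partial>P) \<le> (\<integral>\<omega>. h (norm (L (G \<omega>))) \<partial>P) + \<epsilon> \<and>
      (\<forall>(y, c)\<in>increment_graph \<phi> D\<^sub>\<phi> \<Theta> k. h c \<le> u y)"
  proof (rule lipschitz_envelope[OF P G continuous_on_norm_derivative[OF L D0]])
    show "increment_graph \<phi> D\<^sub>\<phi> \<Theta> l \<subseteq> increment_graph \<phi> D\<^sub>\<phi> \<Theta> k" if "k \<le> l" for k l
      by (rule increment_graph_antimono[OF that \<Theta>[OF that]])
    show "\<exists>r::nat \<Rightarrow> nat. strict_mono r \<and> (\<lambda>k. snd (p (r k))) \<longlonglongrightarrow> norm (L y)"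
      if "y \<in> D0" "\<And>k. p k \<in> increment_graph \<phi> D\<^sub>\<phi> \<Theta> k" "(\<lambda>k. fst (p k)) \<longlonglongrightarrow> y" for y p
      by (rule increment_graph_limit[OF _ that(2)]) (rule lim[OF _ _ _ _ that(3,1)])
  qed (use \<open>0 < \<epsilon>\<close> in auto)
  then obtain k where k: "1 \<le> k" and "\<forall>h\<in>BL1. \<exists>u. (real k)-lipschitz_on UNIV u \<and> range u \<subseteq> {-1..1} \<and>
      (\<integral>\<omega>. u (G \<omega>) \<partial>P) \<le> (\<integral>\<omega>. h (norm (L (G \<omega>))) \<partial>P) + \<epsilon> \<and>
      (\<forall>(y, c)\<in>increment_graph \<phi> D\<^sub>\<phi> \<Theta> k. h c \<le> u y)" by (elim exE conjE)
  from bchoice[OF this(2)] obtain u where u: "\<forall>h\<in>BL1. (real k)-lipschitz_on UNIV (u h) \<and> range (u h) \<subseteq> {-1..1} \<and>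
      (\<integral>\<omega>. u h (G \<omega>) \<partial>P) \<le> (\<integral>\<omega>. h (norm (L (G \<omega>))) \<partial>P) + \<epsilon> \<and>
      (\<forall>(y, c)\<in>increment_graph \<phi> D\<^sub>\<phi> \<Theta> k. h c \<le> u h y)" ..
  show ?thesis
  proof (intro exI[of _ k] conjI k allI impI)
    fix A :: "nat \<Rightarrow> (nat \<Rightarrow> 'x) set"
    assume A: "\<forall>n. \<forall>x\<in>A n. k \<le> n \<and> C n x \<in> \<Theta> k n \<inter> D\<^sub>\<phi> \<and> (\<forall>z\<in>space Q. S n (x, z) \<in> D\<^sub>\<phi>)"
    have "h (sqrt (real n) * norm (\<phi> (S n (x, z)) - \<phi> (C n x))) \<le> u h (sqrt (real n) *\<^sub>R (S n (x, z) - C n x))"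
      if h: "h \<in> BL1" and x: "x \<in> A n" and z: "z \<in> space Q" for h n x z
    proof -
      have n: "1 \<le> n" using A x k by force
      have "C n x + (1 / sqrt (real n)) *\<^sub>R (sqrt (real n) *\<^sub>R (S n (x, z) - C n x)) = S n (x, z)" using n by simp
      then have "(sqrt (real n) *\<^sub>R (S n (x, z) - C n x), sqrt (real n) * norm (\<phi> (S n (x, z)) - \<phi> (C n x)))
          \<in> increment_graph \<phi> D\<^sub>\<phi> \<Theta> k"
        using A x z n unfolding increment_graph_def
        by (intro CollectI case_prodI exI[of _ n] exI[of _ "C n x"]) simp
      with u h show ?thesis by blast
    qed
    with u k show "lipschitz_dominated Q P (\<lambda>n \<omega>. sqrt (real n) *\<^sub>R (S n \<omega> - C n (fst \<omega>))) G
      (\<lambda>n \<omega>. sqrt (real n) * norm (\<phi> (S n \<omega>) - \<phi> (C n (fst \<omega>)))) (\<lambda>\<omega>. norm (L (G \<omega>))) A \<epsilon>"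
      unfolding lipschitz_dominated_def by (intro exI[of _ "real k"] exI[of _ u]) simp
  qed
qed

section \<open>Test and bootstrap statistics\<close>

text \<open>
  The bootstrap values form an unrestricted sequence, whereas points of \<open>obs_space\<close> are undefined
  outside \<open>{..<n}\<close>.
\<close>

lemma empirical_restrict: "empirical H n (restrict x {..<n}) = empirical H n x"
  unfolding empirical_def by (rule distr_cong) (auto simp: space_uniform_count_measure)

theorem theorem2p8:
  fixes H :: "'x measure" and Q :: "'z measure"
    and emb :: "'x measure \<Rightarrow> 'd::real_normed_vector"
    and \<phi> :: "'d \<Rightarrow> 'e::real_normed_vector"
    and D\<^sub>\<phi> D0 :: "'d set"
    and \<phi>'H \<phi>'R :: "'d \<Rightarrow> 'e"
    and R :: "nat \<Rightarrow> (nat \<Rightarrow> 'x) \<Rightarrow> 'x measure"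
    and RH :: 'd
    and Xs :: "nat \<Rightarrow> nat \<Rightarrow> (nat \<Rightarrow> 'x) \<times> 'z \<Rightarrow> 'x"
    and PH :: "'p measure" and GH :: "'p \<Rightarrow> 'd"
    and PR :: "'q measure" and GR :: "'q \<Rightarrow> 'd"
  assumes "prob_space H" and "prob_space Q"
    and R_prob: "\<And>n x. n \<ge> 1 \<Longrightarrow> x \<in> space (obs_space H n) \<Longrightarrow> prob_space (R n x) \<and> sets (R n x) = sets H"
    and Xs_measurable: "\<And>n i. i < n \<Longrightarrow> Xs n i \<in> measurable (boot_space H Q n) H"
    and Xs_indep: "\<And>n x. n \<ge> 1 \<Longrightarrow> x \<in> space (obs_space H n) \<Longrightarrow>
        prob_space.indep_vars Q (\<lambda>_. H) (\<lambda>i z. Xs n i (x, z)) {..<n}"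
    and Xs_distr: "\<And>n x i. i < n \<Longrightarrow> x \<in> space (obs_space H n) \<Longrightarrow>
        distr Q H (\<lambda>z. Xs n i (x, z)) = R n x"
    and dom_empirical: "\<And>n x. n \<ge> 1 \<Longrightarrow> x \<in> space (obs_space H n) \<Longrightarrow> emb (empirical H n x) \<in> D\<^sub>\<phi>"
    and dom_R: "\<And>n x. n \<ge> 1 \<Longrightarrow> x \<in> space (obs_space H n) \<Longrightarrow> emb (R n x) \<in> D\<^sub>\<phi>"
    and D0: "subspace D0" "D0 \<in> sets borel"
    and diff_H: "has_hadamard_derivative \<phi> D\<^sub>\<phi> D0 (emb H) \<phi>'H"
    and diff_R: "has_hadamard_derivative \<phi> D\<^sub>\<phi> D0 RH \<phi>'R"
    and GH: "prob_space PH" "GH \<in> measurable PH borel" "tight_in PH GH" "\<And>\<omega>. \<omega> \<in> space PH \<Longrightarrow> GH \<omega> \<in> D0"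
    and GR: "prob_space PR" "GR \<in> measurable PR borel" "tight_in PR GR" "\<And>\<omega>. \<omega> \<in> space PR \<Longrightarrow> GR \<omega> \<in> D0"
    and conv_H: "weak_conv_HJ (obs_space H) (\<lambda>n x. sqrt (real n) *\<^sub>R (emb (empirical H n x) - emb H)) PH GH"
    and conv_boot: "cond_weak_conv_prob H Q
        (\<lambda>n \<omega>. sqrt (real n) *\<^sub>R (emb (boot_empirical H Xs n \<omega>) - emb (R n (fst \<omega>)))) PR GR"
  shows
    "(asymptotically_tight_in D0 (obs_space H) (\<lambda>n x. sqrt (real n) *\<^sub>R (emb (R n x) - RH)) \<or>
      has_uniform_hadamard_derivative \<phi> D\<^sub>\<phi> D0 RH \<phi>'R \<and>
        tendsto_0_outer_prob H (\<lambda>n x. norm (emb (R n x) - RH))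
      \<longrightarrow>
      (\<phi> (emb H) = 0 \<longrightarrow>
        weak_conv_HJ (obs_space H) (test_stat emb \<phi> H) PH (\<lambda>\<omega>. norm (\<phi>'H (GH \<omega>)))) \<and>
      (\<phi> (emb H) \<noteq> 0 \<longrightarrow> weak_conv_infinity (obs_space H) (test_stat emb \<phi> H)) \<and>
      cond_weak_conv_prob H Q (boot_test_stat emb \<phi> H R Xs) PR (\<lambda>\<omega>. norm (\<phi>'R (GR \<omega>))))
     \<and>
     (has_uniform_hadamard_derivative \<phi> D\<^sub>\<phi> D0 RH \<phi>'R \<and>
        cond_weak_conv_as H Q
          (\<lambda>n \<omega>. sqrt (real n) *\<^sub>R (emb (boot_empirical H Xs n \<omega>) - emb (R n (fst \<omega>)))) PR GR \<and>
        tendsto_0_outer_as H (\<lambda>n x. norm (emb (R n x) - RH))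
      \<longrightarrow>
      cond_weak_conv_as H Q (boot_test_stat emb \<phi> H R Xs) PR (\<lambda>\<omega>. norm (\<phi>'R (GR \<omega>))))"
proof -
  let ?S = "\<lambda>n \<omega>. emb (boot_empirical H Xs n \<omega>)" and ?C = "\<lambda>n x. emb (R n x)"
  let ?Y = "\<lambda>n \<omega>. sqrt (real n) *\<^sub>R (?S n \<omega> - ?C n (fst \<omega>))"
  let ?T = "boot_test_stat emb \<phi> H R Xs" and ?G = "\<lambda>\<omega>. norm (\<phi>'R (GR \<omega>))"
  note obs = prob_space_obs_space[OF \<open>prob_space H\<close>]
  have T: "?T = (\<lambda>n \<omega>. sqrt (real n) * norm (\<phi> (?S n \<omega>) - \<phi> (?C n (fst \<omega>))))"
    by (intro ext) (simp add: boot_test_stat_def)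
  have dom_S: "?S n (x, z) \<in> D\<^sub>\<phi>" if "1 \<le> n" "x \<in> space (obs_space H n)" "z \<in> space Q" for n x z
  proof -
    have "Xs n i (x, z) \<in> space H" if "i < n" for i
      using measurable_space[OF Xs_measurable[OF that]] \<open>x \<in> _\<close> \<open>z \<in> _\<close> by (simp add: space_boot_space)
    then have "restrict (\<lambda>i. Xs n i (x, z)) {..<n} \<in> space (obs_space H n)"
      by (auto simp: obs_space_def space_PiM)
    from dom_empirical[OF \<open>1 \<le> n\<close> this] show ?thesis by (simp add: boot_empirical_def empirical_restrict)
  qed
  have L: "continuous_linear_on_span D0 \<phi>'R" using diff_R by (simp add: has_hadamard_derivative_def)
  let ?dominated = "\<lambda>A \<epsilon>. lipschitz_dominated Q PR ?Y GR ?T ?G A \<epsilon>"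

  have null: "weak_conv_HJ (obs_space H) (test_stat emb \<phi> H) PH (\<lambda>\<omega>. norm (\<phi>'H (GH \<omega>)))"
    if "\<phi> (emb H) = 0"
  proof -
    have "test_stat emb \<phi> H = (\<lambda>n x. sqrt (real n) * norm (\<phi> (emb (empirical H n x)) - \<phi> (emb H)))"
      using that by (intro ext) (simp add: test_stat_def)
    then show ?thesis
      using weak_conv_delta_method[OF obs GH(1) D0(1) diff_H GH(2,4) dom_empirical conv_H] by simp
  qed
  have alternative: "weak_conv_infinity (obs_space H) (test_stat emb \<phi> H)" if "\<phi> (emb H) \<noteq> 0"
  proof -
    have "test_stat emb \<phi> H = (\<lambda>n x. sqrt (real n) * norm (\<phi> (emb (empirical H n x))))"
      by (intro ext) (simp add: test_stat_def)
    then show ?thesis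
      using weak_conv_infinity_delta_method[OF obs GH(1) diff_H that GH(2,4) dom_empirical conv_H] by simp
  qed

  \<comment> \<open>Every neighbourhood of a compact set contains the rescaled centers with inner probability at least \<open>1 - \<epsilon> / 2\<close> in the limit; the other half of \<open>\<epsilon>\<close> is the room for finite \<open>n\<close> and for measurable events inside it.\<close>
  have tight: "\<exists>A. (\<forall>n. A n \<in> sets (obs_space H n)) \<and> ?dominated A \<epsilon> \<and>
      (\<forall>\<^sub>F n in sequentially. 1 - \<epsilon> \<le> measure (obs_space H n) (A n))"
    if asym: "asymptotically_tight_in D0 (obs_space H) (\<lambda>n x. sqrt (real n) *\<^sub>R (?C n x - RH))" and "0 < \<epsilon>" for \<epsilon>
  proof -
    let ?s = "\<lambda>n x. sqrt (real n) *\<^sub>R (?C n x - RH)"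
    have "0 < \<epsilon> / 2" using \<open>0 < \<epsilon>\<close> by simp
    with asym obtain K where K: "compact K" "K \<subseteq> D0" and inner: "\<And>\<delta>. 0 < \<delta> \<Longrightarrow>
        ereal (1 - \<epsilon> / 2) \<le> liminf (\<lambda>n. ereal (inner_prob (obs_space H n)
          {x \<in> space (obs_space H n). ?s n x \<in> (\<Union>\<kappa>\<in>K. ball \<kappa> \<delta>)}))"
      unfolding asymptotically_tight_in_def by blast
    define \<Theta> where "\<Theta> k m = {\<theta>. sqrt (real m) *\<^sub>R (\<theta> - RH) \<in> (\<Union>\<kappa>\<in>K. ball \<kappa> (1 / real (Suc k)))}" for k m :: nat
    have \<Theta>_anti: "\<Theta> l m \<subseteq> \<Theta> k m" if "k \<le> l" for k l m
    proof -
      have "1 / real (Suc l) \<le> 1 / real (Suc k)" using that by (simp add: frac_le)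
      then show ?thesis unfolding \<Theta>_def by (fastforce intro: less_le_trans)
    qed
    have "\<exists>k\<ge>1. \<forall>A. (\<forall>n. \<forall>x\<in>A n. k \<le> n \<and> ?C n x \<in> \<Theta> k n \<inter> D\<^sub>\<phi> \<and> (\<forall>z\<in>space Q. ?S n (x, z) \<in> D\<^sub>\<phi>)) \<longrightarrow>
        ?dominated A \<epsilon>"
      unfolding T
    proof (rule lipschitz_dominated_delta_method[OF GR(1) D0(1) L GR(2,4) \<Theta>_anti _ \<open>0 < \<epsilon>\<close>])
      fix m :: "nat \<Rightarrow> nat" and \<theta>s ys y
      assume *: "\<And>k. max 1 k \<le> m k" "\<And>k. \<theta>s k \<in> \<Theta> k (m k)" "\<And>k. \<theta>s k \<in> D\<^sub>\<phi>"
        "\<And>k. \<theta>s k + (1 / sqrt (real (m k))) *\<^sub>R ys k \<in> D\<^sub>\<phi>" "ys \<longlonglongrightarrow> y" "y \<in> D0"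
      have "sqrt (real (m k)) *\<^sub>R (\<theta>s k - RH) \<in> (\<Union>\<kappa>\<in>K. ball \<kappa> (1 / real (Suc k)))" for k
        using *(2)[of k] by (simp only: \<Theta>_def mem_Collect_eq)
      from hadamard_sqrt_limit_compact[OF diff_R D0(1) K *(1,5,6) this *(3,4)]
      show "\<exists>r::nat \<Rightarrow> nat. strict_mono r \<and> (\<lambda>k. sqrt (real (m (r k))) *\<^sub>R
        (\<phi> (\<theta>s (r k) + (1 / sqrt (real (m (r k)))) *\<^sub>R ys (r k)) - \<phi> (\<theta>s (r k)))) \<longlonglongrightarrow> \<phi>'R y" .
    qed
    then obtain k where k: "1 \<le> k" "\<And>A. (\<forall>n. \<forall>x\<in>A n. k \<le> n \<and> ?C n x \<in> \<Theta> k n \<inter> D\<^sub>\<phi> \<and>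
        (\<forall>z\<in>space Q. ?S n (x, z) \<in> D\<^sub>\<phi>)) \<longrightarrow> ?dominated A \<epsilon>" by blast
    let ?U = "\<lambda>n. {x \<in> space (obs_space H n). ?s n x \<in> (\<Union>\<kappa>\<in>K. ball \<kappa> (1 / real (Suc k)))}"
    have "\<forall>\<^sub>F n in sequentially. 1 - \<epsilon> < inner_prob (obs_space H n) (?U n)"
      using \<open>0 < \<epsilon>\<close> by (intro liminf_ereal_gtD[OF inner]) auto
    then obtain N where N: "\<And>n. N \<le> n \<Longrightarrow> 1 - \<epsilon> < inner_prob (obs_space H n) (?U n)"
      by (auto simp: eventually_sequentially)
    have "\<forall>n. \<exists>A. A \<in> sets (obs_space H n) \<and> A \<subseteq> ?U n \<and>
        (if max N k \<le> n then 1 - \<epsilon> < measure (obs_space H n) A else A = {})"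
    proof
      fix n
      show "\<exists>A. A \<in> sets (obs_space H n) \<and> A \<subseteq> ?U n \<and>
        (if max N k \<le> n then 1 - \<epsilon> < measure (obs_space H n) A else A = {})"
      proof (cases "max N k \<le> n")
        case True
        then have "1 - \<epsilon> < inner_prob (obs_space H n) (?U n)" by (intro N) simp
        from prob_space.inner_prob_lessD[OF obs this] obtain A where
          "A \<in> sets (obs_space H n)" "A \<subseteq> ?U n" "1 - \<epsilon> < measure (obs_space H n) A" by (elim bexE conjE)
        with True show ?thesis by (intro exI[of _ A] conjI) simp_all
      next
        case False
        then show ?thesis by (intro exI[of _ "{}"]) (simp only: if_False, simp)
      qed
    qed
    from choice[OF this] obtain A where A: "\<forall>n. A n \<in> sets (obs_space H n) \<and> A n \<subseteq> ?U n \<and>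
        (if max N k \<le> n then 1 - \<epsilon> < measure (obs_space H n) (A n) else A n = {})" ..
    have "k \<le> n \<and> ?C n x \<in> \<Theta> k n \<inter> D\<^sub>\<phi> \<and> (\<forall>z\<in>space Q. ?S n (x, z) \<in> D\<^sub>\<phi>)" if x: "x \<in> A n" for n x
    proof -
      have "max N k \<le> n" using A[rule_format, of n] x by (metis emptyE)
      moreover have U: "x \<in> ?U n" using A x by blast
      moreover have "?C n x \<in> \<Theta> k n" using U by (simp only: \<Theta>_def mem_Collect_eq)
      ultimately show ?thesis using k(1) dom_R[of n x] dom_S[of n x] by auto
    qed
    then have "?dominated A \<epsilon>" using k(2)[of A] by simp
    moreover have "\<forall>\<^sub>F n in sequentially. 1 - \<epsilon> \<le> measure (obs_space H n) (A n)"
    proof (rule eventually_sequentiallyI)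
      fix n assume "max N k \<le> n"
      with A[rule_format, of n] show "1 - \<epsilon> \<le> measure (obs_space H n) (A n)" by simp
    qed
    moreover have "\<forall>n. A n \<in> sets (obs_space H n)" using A by simp
    ultimately show ?thesis by (intro exI[of _ A] conjI)
  qed

  \<comment> \<open>Centers are confined to a ball around the limit. The statement leaves \<open>\<Delta>\<close> open to serve both modes of convergence.\<close>
  have uniform: "\<exists>k\<ge>1. \<forall>\<Delta>. outer_majorized H (\<lambda>n x. norm (?C n x - RH)) \<Delta> \<longrightarrow>
      ?dominated (\<lambda>n. {x \<in> space (obs_space H n). k \<le> n \<and> \<bar>\<Delta> n x\<bar> \<le> 1 / real (Suc k)}) \<epsilon>"
    if unif: "has_uniform_hadamard_derivative \<phi> D\<^sub>\<phi> D0 RH \<phi>'R" and "0 < \<epsilon>" for \<epsilon>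
  proof -
    define \<Theta> where "\<Theta> k m = {\<theta>. norm (\<theta> - RH) \<le> 1 / real (Suc k)}" for k m :: nat
    have \<Theta>_anti: "\<Theta> l m \<subseteq> \<Theta> k m" if "k \<le> l" for k l m
    proof -
      have "1 / real (Suc l) \<le> 1 / real (Suc k)" using that by (simp add: frac_le)
      then show ?thesis unfolding \<Theta>_def by auto
    qed
    have "\<exists>k\<ge>1. \<forall>A. (\<forall>n. \<forall>x\<in>A n. k \<le> n \<and> ?C n x \<in> \<Theta> k n \<inter> D\<^sub>\<phi> \<and> (\<forall>z\<in>space Q. ?S n (x, z) \<in> D\<^sub>\<phi>)) \<longrightarrow>
        ?dominated A \<epsilon>"
      unfolding T
    proof (rule lipschitz_dominated_delta_method[OF GR(1) D0(1) L GR(2,4) \<Theta>_anti _ \<open>0 < \<epsilon>\<close>])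
      fix m :: "nat \<Rightarrow> nat" and \<theta>s ys y
      assume *: "\<And>k. max 1 k \<le> m k" "\<And>k. \<theta>s k \<in> \<Theta> k (m k)" "\<And>k. \<theta>s k \<in> D\<^sub>\<phi>"
        "\<And>k. \<theta>s k + (1 / sqrt (real (m k))) *\<^sub>R ys k \<in> D\<^sub>\<phi>" "ys \<longlonglongrightarrow> y" "y \<in> D0"
      have "(\<lambda>k. \<theta>s k - RH) \<longlonglongrightarrow> 0"
      proof (rule Lim_null_comparison)
        show "(\<lambda>k. 1 / real (Suc k)) \<longlonglongrightarrow> 0" by (rule LIMSEQ_Suc[OF lim_1_over_n])
        show "\<forall>\<^sub>F k in sequentially. norm (\<theta>s k - RH) \<le> 1 / real (Suc k)"
          using *(2) by (intro always_eventually allI) (simp add: \<Theta>_def)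
      qed
      then have "\<theta>s \<longlonglongrightarrow> RH" by (rule LIM_zero_cancel)
      from uniform_hadamard_sqrt_limit[OF unif *(1,5,6) this *(3,4)]
      show "\<exists>r::nat \<Rightarrow> nat. strict_mono r \<and> (\<lambda>k. sqrt (real (m (r k))) *\<^sub>R
        (\<phi> (\<theta>s (r k) + (1 / sqrt (real (m (r k)))) *\<^sub>R ys (r k)) - \<phi> (\<theta>s (r k)))) \<longlonglongrightarrow> \<phi>'R y"
        by (intro exI[of _ id]) (simp add: strict_mono_id)
    qed
    then obtain k where k: "1 \<le> k" "\<And>A. (\<forall>n. \<forall>x\<in>A n. k \<le> n \<and> ?C n x \<in> \<Theta> k n \<inter> D\<^sub>\<phi> \<and>
        (\<forall>z\<in>space Q. ?S n (x, z) \<in> D\<^sub>\<phi>)) \<longrightarrow> ?dominated A \<epsilon>" by blast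
    show ?thesis
    proof (intro exI[of _ k] conjI k(1) allI impI)
      fix \<Delta> assume \<Delta>: "outer_majorized H (\<lambda>n x. norm (?C n x - RH)) \<Delta>"
      let ?A = "\<lambda>n. {x \<in> space (obs_space H n). k \<le> n \<and> \<bar>\<Delta> n x\<bar> \<le> 1 / real (Suc k)}"
      have "k \<le> n \<and> ?C n x \<in> \<Theta> k n \<inter> D\<^sub>\<phi> \<and> (\<forall>z\<in>space Q. ?S n (x, z) \<in> D\<^sub>\<phi>)" if "x \<in> ?A n" for n x
      proof -
        from that have x: "x \<in> space (obs_space H n)" "k \<le> n" "\<bar>\<Delta> n x\<bar> \<le> 1 / real (Suc k)" by auto
        have n: "1 \<le> n" using x(2) k(1) by simp
        have "norm (?C n x - RH) \<le> \<Delta> n x" using \<Delta> x(1) by (simp add: outer_majorized_def)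
        also have "\<dots> \<le> 1 / real (Suc k)" using x(3) by simp
        finally have "?C n x \<in> \<Theta> k n" by (simp add: \<Theta>_def)
        then show ?thesis using x(2) dom_R[OF n x(1)] dom_S[OF n x(1)] by simp
      qed
      then have "\<forall>n. \<forall>x\<in>?A n. k \<le> n \<and> ?C n x \<in> \<Theta> k n \<inter> D\<^sub>\<phi> \<and> (\<forall>z\<in>space Q. ?S n (x, z) \<in> D\<^sub>\<phi>)"
        by (intro allI ballI)
      with k(2)[of ?A] show "?dominated ?A \<epsilon>" by (rule mp)
    qed
  qed
  have good_sets: "{x \<in> space (obs_space H n). k \<le> n \<and> \<bar>\<Delta> n x\<bar> \<le> c} \<in> sets (obs_space H n)"
    if "outer_majorized H Z \<Delta>" for Z \<Delta> n k and c :: real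
  proof -
    have [measurable]: "\<Delta> n \<in> borel_measurable (obs_space H n)" using that by (simp add: outer_majorized_def)
    show ?thesis by measurable
  qed

  have boot_prob: "cond_weak_conv_prob H Q ?T PR ?G"
    if "asymptotically_tight_in D0 (obs_space H) (\<lambda>n x. sqrt (real n) *\<^sub>R (?C n x - RH)) \<or>
      has_uniform_hadamard_derivative \<phi> D\<^sub>\<phi> D0 RH \<phi>'R \<and> tendsto_0_outer_prob H (\<lambda>n x. norm (?C n x - RH))"
  proof (rule cond_weak_conv_prob_transfer[OF \<open>prob_space H\<close> \<open>prob_space Q\<close> GR(1) conv_boot])
    fix \<epsilon> :: real assume "0 < \<epsilon>"
    from that show "\<exists>A. (\<forall>n. A n \<in> sets (obs_space H n)) \<and> ?dominated A \<epsilon> \<and>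
      (\<forall>\<^sub>F n in sequentially. 1 - \<epsilon> \<le> measure (obs_space H n) (A n))"
    proof
      assume "asymptotically_tight_in D0 (obs_space H) (\<lambda>n x. sqrt (real n) *\<^sub>R (?C n x - RH))"
      from tight[OF this \<open>0 < \<epsilon>\<close>] show ?thesis .
    next
      assume "has_uniform_hadamard_derivative \<phi> D\<^sub>\<phi> D0 RH \<phi>'R \<and> tendsto_0_outer_prob H (\<lambda>n x. norm (?C n x - RH))"
      then obtain \<Delta> where unif: "has_uniform_hadamard_derivative \<phi> D\<^sub>\<phi> D0 RH \<phi>'R"
        and \<Delta>: "outer_majorized H (\<lambda>n x. norm (?C n x - RH)) \<Delta>"
        and lim: "\<And>\<epsilon>. 0 < \<epsilon> \<Longrightarrow> (\<lambda>n. measure (obs_space H n) {x \<in> space (obs_space H n). \<bar>\<Delta> n x\<bar> > \<epsilon>}) \<longlonglongrightarrow> 0"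
        unfolding tendsto_0_outer_prob_def by blast
      from uniform[OF unif \<open>0 < \<epsilon>\<close>] obtain k where
        k: "?dominated (\<lambda>n. {x \<in> space (obs_space H n). k \<le> n \<and> \<bar>\<Delta> n x\<bar> \<le> 1 / real (Suc k)}) \<epsilon>" using \<Delta> by blast
      let ?A = "\<lambda>n. {x \<in> space (obs_space H n). k \<le> n \<and> \<bar>\<Delta> n x\<bar> \<le> 1 / real (Suc k)}"
      have "\<forall>\<^sub>F n in sequentially.
          measure (obs_space H n) {x \<in> space (obs_space H n). \<bar>\<Delta> n x\<bar> > 1 / real (Suc k)} < \<epsilon>"
        by (rule order_tendstoD(2)[OF lim \<open>0 < \<epsilon>\<close>]) simp
      then have "\<forall>\<^sub>F n in sequentially. 1 - \<epsilon> \<le> measure (obs_space H n) (?A n)"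
        using eventually_ge_at_top[of k]
      proof eventually_elim
        case (elim n)
        interpret prob_space "obs_space H n" by (rule obs)
        have bad: "space (obs_space H n) - ?A n = {x \<in> space (obs_space H n). \<bar>\<Delta> n x\<bar> > 1 / real (Suc k)}"
          using elim(2) by auto
        have "prob (space (obs_space H n) - ?A n) = 1 - prob (?A n)" by (rule prob_compl[OF good_sets[OF \<Delta>]])
        with elim(1) show ?case unfolding bad by linarith
      qed
      with k good_sets[OF \<Delta>] show ?thesis by (intro exI[of _ ?A] conjI allI)
    qed
  qed

  have boot_as: "cond_weak_conv_as H Q ?T PR ?G"
    if unif: "has_uniform_hadamard_derivative \<phi> D\<^sub>\<phi> D0 RH \<phi>'R" and Y: "cond_weak_conv_as H Q ?Y PR GR"
      and as: "tendsto_0_outer_as H (\<lambda>n x. norm (?C n x - RH))"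
  proof (rule cond_weak_conv_as_transfer[OF \<open>prob_space H\<close> \<open>prob_space Q\<close> GR(1) Y])
    fix \<epsilon> :: real assume "0 < \<epsilon>"
    from as obtain \<Delta> where \<Delta>: "outer_majorized H (\<lambda>n x. norm (?C n x - RH)) \<Delta>"
      and lim: "AE x in PiM UNIV (\<lambda>_::nat. H). (\<lambda>n. \<Delta> n (restrict x {..<n})) \<longlonglongrightarrow> 0"
      unfolding tendsto_0_outer_as_def by blast
    from uniform[OF unif \<open>0 < \<epsilon>\<close>] obtain k where
      k: "?dominated (\<lambda>n. {x \<in> space (obs_space H n). k \<le> n \<and> \<bar>\<Delta> n x\<bar> \<le> 1 / real (Suc k)}) \<epsilon>" using \<Delta> by blast
    let ?A = "\<lambda>n. {x \<in> space (obs_space H n). k \<le> n \<and> \<bar>\<Delta> n x\<bar> \<le> 1 / real (Suc k)}"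
    have "AE x in PiM UNIV (\<lambda>_::nat. H). \<forall>\<^sub>F n in sequentially. restrict x {..<n} \<in> ?A n"
      using lim AE_space
    proof eventually_elim
      case (elim x)
      have x: "restrict x {..<n} \<in> space (obs_space H n)" for n
        using elim(2) by (auto simp: obs_space_def space_PiM)
      have "\<forall>\<^sub>F n in sequentially. dist (\<Delta> n (restrict x {..<n})) 0 < 1 / real (Suc k)"
        by (rule tendstoD[OF elim(1)]) simp
      then show ?case using eventually_ge_at_top[of k]
        by eventually_elim (simp add: x dist_real_def less_imp_le)
    qed
    with k good_sets[OF \<Delta>] show "\<exists>A. (\<forall>n. A n \<in> sets (obs_space H n)) \<and> ?dominated A \<epsilon> \<and>
        (AE x in PiM UNIV (\<lambda>_::nat. H). \<forall>\<^sub>F n in sequentially. restrict x {..<n} \<in> A n)"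
      by (intro exI[of _ ?A] conjI allI)
  qed
  show ?thesis using null alternative boot_prob boot_as by (intro conjI impI) (elim conjE, assumption | simp)+
qed

end
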